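(* Let $Y$ be a smooth projective complex variety with $H^2(Y,\mathcal O_Y)=0$. Then the boundary map $\partial: H^2(Y,\mathcal O_Y^* )\to H^3(Y,\mathbb Z)$ in the long exact cohomology sequence of the exponential sequence $0\to\mathbb Z\to\mathcal O_Y\to\mathcal O_Y^*\to 0$ induces an isomorphism $$\operatorname{Br}(Y)=H^2(Y,\mathcal O_Y^* )_{\mathrm{tors}}\xrightarrow{\ \sim\ }H^3(Y,\mathbb Z)_{\mathrm{tors}}.$$
   Context: Cohomology is taken on the complex analytic space associated to $Y$; $\mathcal O_Y$ is the sheaf of holomorphic functions, $\mathcal O_Y^*$ the sheaf of nowhere vanishing holomorphic functions, and the map $\mathcal O_Y\to\mathcal O_Y^*$ is $f\mapsto\exp(2\pi i f)$. The subscript $\mathrm{tors}$ denotes the torsion subgroup. The cohomological Brauer group is defined as $\operatorname{Br}(Y):=H^2(Y,\mathcal O_Y^* )_{\mathrm{tors}}$. *)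

theory Defs
  imports
    "HOL-Analysis.Analysis"
    "HOL-Algebra.Product_Groups"
    "HOL-Library.Poly_Mapping"
    "HOL-Library.Extended_Nat"
begin

section \<open>Sheaf cohomology by the Godement resolution\<close>

text \<open>
  Presheaves of abelian groups on a topological space. All groups, including the additive ones,
  are HOL-Algebra monoid records, so a sheaf such as the sheaf of holomorphic functions has
  \<open>mult = (+)\<close>. Only the values on open sets matter.
\<close>

record ('x, 'a) presheaf =
  sections :: "'x set \<Rightarrow> 'a monoid"
  restr :: "'x set \<Rightarrow> 'x set \<Rightarrow> 'a \<Rightarrow> 'a"
    \<comment> \<open>\<open>restr F U V\<close> restricts sections from \<open>U\<close> to \<open>V \<subseteq> U\<close>\<close>

definition germ ::
  "'x topology \<Rightarrow> ('x, 'a) presheaf \<Rightarrow> 'x \<Rightarrow> 'x set \<Rightarrow> 'a \<Rightarrow> ('x set \<times> 'a) set" where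
  "germ X F x U s =
     {(V, t). openin X V \<and> x \<in> V \<and> t \<in> carrier (sections F V) \<and>
              (\<exists>W. openin X W \<and> x \<in> W \<and> W \<subseteq> U \<inter> V \<and> restr F U W s = restr F V W t)}"

text \<open>
  Operations on quotients (germs, cosets) are written as unions over all representatives; since
  they do not depend on the representatives, each union is over copies of one and the same class.
\<close>

definition stalk :: "'x topology \<Rightarrow> ('x, 'a) presheaf \<Rightarrow> 'x \<Rightarrow> (('x set \<times> 'a) set) monoid" where
  "stalk X F x =
     \<lparr>carrier = {germ X F x U s |U s. openin X U \<and> x \<in> U \<and> s \<in> carrier (sections F U)},
      monoid.mult = (\<lambda>g h. \<Union>(U, s)\<in>g. \<Union>(V, t)\<in>h.
         germ X F x (U \<inter> V)
           (restr F U (U \<inter> V) s \<otimes>\<^bsub>sections F (U \<inter> V)\<^esub> restr F V (U \<inter> V) t)),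
      one = germ X F x (topspace X) \<one>\<^bsub>sections F (topspace X)\<^esub>\<rparr>"

definition stalk_map ::
  "'x topology \<Rightarrow> ('x, 'b) presheaf \<Rightarrow> ('x set \<Rightarrow> 'a \<Rightarrow> 'b) \<Rightarrow> 'x
    \<Rightarrow> ('x set \<times> 'a) set \<Rightarrow> ('x set \<times> 'b) set" where
  "stalk_map X G \<phi> x g = (\<Union>(U, s)\<in>g. germ X G x U (\<phi> U s))"

text \<open>The sheaf of not necessarily continuous sections, \<open>C\<^sup>0(F)(U) = \<Prod>x\<in>U. F\<^sub>x\<close>, with the
  canonical map \<open>F \<rightarrow> C\<^sup>0(F)\<close>.\<close>

definition godement ::
  "'x topology \<Rightarrow> ('x, 'a) presheaf \<Rightarrow> ('x, 'x \<Rightarrow> ('x set \<times> 'a) set) presheaf" where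
  "godement X F = \<lparr>sections = (\<lambda>U. product_group U (stalk X F)), restr = (\<lambda>U V f. restrict f V)\<rparr>"

definition godement_unit ::
  "'x topology \<Rightarrow> ('x, 'a) presheaf \<Rightarrow> 'x set \<Rightarrow> 'a \<Rightarrow> 'x \<Rightarrow> ('x set \<times> 'a) set" where
  "godement_unit X F U s = (\<lambda>x\<in>U. germ X F x U s)"

definition godement_map ::
  "'x topology \<Rightarrow> ('x, 'b) presheaf \<Rightarrow> ('x set \<Rightarrow> 'a \<Rightarrow> 'b) \<Rightarrow> 'x set
    \<Rightarrow> ('x \<Rightarrow> ('x set \<times> 'a) set) \<Rightarrow> 'x \<Rightarrow> ('x set \<times> 'b) set" where
  "godement_map X G \<phi> U f = (\<lambda>x\<in>U. stalk_map X G \<phi> x (f x))"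

definition unit_image ::
  "'x topology \<Rightarrow> ('x, 'a) presheaf \<Rightarrow> 'x set \<Rightarrow> ('x \<Rightarrow> ('x set \<times> 'a) set) set" where
  "unit_image X F U = godement_unit X F U ` carrier (sections F U)"

text \<open>
  The presheaf cokernel \<open>Q(F)\<close> of \<open>F \<rightarrow> C\<^sup>0(F)\<close>. The Godement resolution of \<open>F\<close> is
  \<open>C\<^sup>n(F) = C\<^sup>0(Z\<^sup>n)\<close>, where \<open>Z\<^sup>0 = F\<close> and \<open>Z\<^sup>n\<^sup>+\<^sup>1\<close> is the sheaf associated with \<open>Q(Z\<^sup>n)\<close>. As
  \<open>C\<^sup>0\<close> only depends on stalks, sheafifying makes no difference to it: \<open>C\<^sup>n(F) = C\<^sup>0(Q\<^sup>n(F))\<close>.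
\<close>

definition godement_quot ::
  "'x topology \<Rightarrow> ('x, 'a) presheaf \<Rightarrow> ('x, ('x \<Rightarrow> ('x set \<times> 'a) set) set) presheaf" where
  "godement_quot X F =
     \<lparr>sections = (\<lambda>U. sections (godement X F) U Mod unit_image X F U),
      restr = (\<lambda>U V S. \<Union>f\<in>S. unit_image X F V #>\<^bsub>sections (godement X F) V\<^esub> restrict f V)\<rparr>"

definition godement_quot_map ::
  "'x topology \<Rightarrow> ('x, 'b) presheaf \<Rightarrow> ('x set \<Rightarrow> 'a \<Rightarrow> 'b) \<Rightarrow> 'x set
    \<Rightarrow> ('x \<Rightarrow> ('x set \<times> 'a) set) set \<Rightarrow> ('x \<Rightarrow> ('x set \<times> 'b) set) set" where
  "godement_quot_map X G \<phi> U S =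
     (\<Union>f\<in>S. unit_image X G U #>\<^bsub>sections (godement X G) U\<^esub> godement_map X G \<phi> U f)"

text \<open>Global sections of \<open>C\<^sup>0(F)\<close>, and the differential
  \<open>C\<^sup>0(F) \<rightarrow> Q(F) \<rightarrow> C\<^sup>0(Q(F)) = C\<^sup>1(F)\<close> on them.\<close>

definition cochains ::
  "'x topology \<Rightarrow> ('x, 'a) presheaf \<Rightarrow> ('x \<Rightarrow> ('x set \<times> 'a) set) monoid" where
  "cochains X F = sections (godement X F) (topspace X)"

definition differential ::
  "'x topology \<Rightarrow> ('x, 'a) presheaf \<Rightarrow> ('x \<Rightarrow> ('x set \<times> 'a) set)
    \<Rightarrow> 'x \<Rightarrow> ('x set \<times> ('x \<Rightarrow> ('x set \<times> 'a) set) set) set" where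
  "differential X F f =
     godement_unit X (godement_quot X F) (topspace X)
       (unit_image X F (topspace X) #>\<^bsub>cochains X F\<^esub> f)"

definition cochain_map ::
  "'x topology \<Rightarrow> ('x, 'b) presheaf \<Rightarrow> ('x set \<Rightarrow> 'a \<Rightarrow> 'b)
    \<Rightarrow> ('x \<Rightarrow> ('x set \<times> 'a) set) \<Rightarrow> 'x \<Rightarrow> ('x set \<times> 'b) set" where
  "cochain_map X G \<phi> = godement_map X G \<phi> (topspace X)"

text \<open>
  \<open>H\<^sup>1(X, F)\<close> is the cohomology at the middle of \<open>\<Gamma>C\<^sup>0(F) \<rightarrow> \<Gamma>C\<^sup>1(F) \<rightarrow> \<Gamma>C\<^sup>2(F)\<close>. The part
  \<open>\<Gamma>C\<^sup>n(F) \<rightarrow> \<Gamma>C\<^sup>n\<^sup>+\<^sup>1(F) \<rightarrow> \<Gamma>C\<^sup>n\<^sup>+\<^sup>2(F)\<close> of the Godement complex of \<open>F\<close> is the corresponding part in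
  degrees 0, 1, 2 for \<open>Q\<^sup>n(F)\<close>, so \<open>H\<^sup>n\<^sup>+\<^sup>1(X, F)\<close> is literally \<open>H\<^sup>1(X, Q\<^sup>n(F))\<close>. (The type of
  cochains grows with the degree, so the degree cannot be an argument.)
\<close>

definition cocycles1 ::
  "'x topology \<Rightarrow> ('x, 'a) presheaf
    \<Rightarrow> ('x \<Rightarrow> ('x set \<times> ('x \<Rightarrow> ('x set \<times> 'a) set) set) set) monoid" where
  "cocycles1 X F =
     (cochains X (godement_quot X F))
       \<lparr>carrier := kernel (cochains X (godement_quot X F))
                     (cochains X (godement_quot X (godement_quot X F)))
                     (differential X (godement_quot X F))\<rparr>"

definition coboundaries1 ::
  "'x topology \<Rightarrow> ('x, 'a) presheaf
    \<Rightarrow> ('x \<Rightarrow> ('x set \<times> ('x \<Rightarrow> ('x set \<times> 'a) set) set) set) set" where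
  "coboundaries1 X F = differential X F ` carrier (cochains X F)"

definition sheaf_H1 ::
  "'x topology \<Rightarrow> ('x, 'a) presheaf
    \<Rightarrow> ('x \<Rightarrow> ('x set \<times> ('x \<Rightarrow> ('x set \<times> 'a) set) set) set) set monoid" where
  "sheaf_H1 X F = cocycles1 X F Mod coboundaries1 X F"

definition "sheaf_H2 X F = sheaf_H1 X (godement_quot X F)"

definition "sheaf_H3 X F = sheaf_H2 X (godement_quot X F)"

text \<open>
  Boundary maps of the long exact sequence of \<open>0 \<rightarrow> A \<rightarrow>\<^sub>\<phi> B \<rightarrow>\<^sub>\<psi> C \<rightarrow> 0\<close>: to \<open>\<xi> = [c]\<close> one assigns
  \<open>[a]\<close>, where \<open>\<psi> b = c\<close> and \<open>\<phi> a = d b\<close>. In degree 1, \<open>c \<in> \<Gamma>C\<^sup>1(C)\<close>, \<open>b \<in> \<Gamma>C\<^sup>1(B)\<close> and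
  \<open>a \<in> \<Gamma>C\<^sup>2(A)\<close>; degree 2 is degree 1 for \<open>0 \<rightarrow> Q(A) \<rightarrow> Q(B) \<rightarrow> Q(C) \<rightarrow> 0\<close>.
\<close>

definition boundary1 where
  "boundary1 X A B \<phi> C \<psi> \<xi> =
     (let QA = godement_quot X A; QB = godement_quot X B; QC = godement_quot X C;
          \<psi>\<^sub>1 = cochain_map X QC (godement_quot_map X C \<psi>);
          \<phi>\<^sub>2 = cochain_map X (godement_quot X QB)
                 (godement_quot_map X QB (godement_quot_map X B \<phi>))
      in THE \<eta>. \<exists>b\<in>carrier (cochains X QB). \<exists>a\<in>carrier (cocycles1 X QA).
           \<psi>\<^sub>1 b \<in> \<xi> \<and> \<phi>\<^sub>2 a = differential X QB b \<and>
           \<eta> = coboundaries1 X QA #>\<^bsub>cocycles1 X QA\<^esub> a)"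

definition boundary2 where
  "boundary2 X A B \<phi> C \<psi> =
     boundary1 X (godement_quot X A) (godement_quot X B) (godement_quot_map X B \<phi>)
       (godement_quot X C) (godement_quot_map X C \<psi>)"

definition torsion_subgroup :: "'a monoid \<Rightarrow> 'a monoid" where
  "torsion_subgroup G = G\<lparr>carrier := {x \<in> carrier G. \<exists>n::nat. n > 0 \<and> x [^]\<^bsub>G\<^esub> n = \<one>\<^bsub>G\<^esub>}\<rparr>"


section \<open>Smooth projective complex varieties\<close>

text \<open>
  Points of the projective space of dimension \<open>CARD('n) - 1\<close> are the lines through the origin of
  \<open>\<complex>\<^sup>n\<close>. Homogeneous coordinates are indexed by the type \<open>'n\<close>.
\<close>

definition proj_point :: "complex ^ 'n \<Rightarrow> (complex ^ 'n) set" where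
  "proj_point v = range (\<lambda>c. c *s v)"

definition proj_space :: "(complex ^ 'n) set set" where
  "proj_space = proj_point ` (UNIV - {0})"

text \<open>Polynomials in the variables \<open>X\<^sub>i\<close>, \<open>i :: 'n\<close>, are finitely supported functions from exponent
  vectors to coefficients.\<close>

type_synonym 'n cpoly = "('n \<Rightarrow>\<^sub>0 nat) \<Rightarrow>\<^sub>0 complex"

definition cpoly_eval :: "('n::finite) cpoly \<Rightarrow> complex ^ 'n \<Rightarrow> complex" where
  "cpoly_eval p v =
     (\<Sum>m\<in>Poly_Mapping.keys p. Poly_Mapping.lookup p m * (\<Prod>i\<in>UNIV. (v $ i) ^ Poly_Mapping.lookup m i))"

definition homogeneous :: "('n::finite) cpoly \<Rightarrow> bool" where
  "homogeneous p \<longleftrightarrow>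
     (\<exists>d. \<forall>m\<in>Poly_Mapping.keys p. (\<Sum>i\<in>UNIV. Poly_Mapping.lookup m i) = d)"

definition vanishes_at :: "('n::finite) cpoly \<Rightarrow> (complex ^ 'n) set \<Rightarrow> bool" where
  "vanishes_at p L \<longleftrightarrow> (\<forall>v\<in>L - {0}. cpoly_eval p v = 0)"

definition zariski_closed :: "(complex ^ 'n) set set \<Rightarrow> bool" where
  "zariski_closed Z \<longleftrightarrow>
     (\<exists>S. (\<forall>p\<in>S. homogeneous p) \<and> Z = {L \<in> proj_space. \<forall>p\<in>S. vanishes_at p L})"

definition projective_variety :: "(complex ^ 'n) set set \<Rightarrow> bool" where
  "projective_variety Y \<longleftrightarrow> zariski_closed Y \<and> Y \<noteq> {} \<and>
     (\<forall>Z\<^sub>1 Z\<^sub>2. zariski_closed Z\<^sub>1 \<and> zariski_closed Z\<^sub>2 \<and> Y = Z\<^sub>1 \<union> Z\<^sub>2 \<longrightarrow> Y = Z\<^sub>1 \<or> Y = Z\<^sub>2)"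

text \<open>The Krull dimension.\<close>

definition variety_dim :: "(complex ^ 'n) set set \<Rightarrow> enat" where
  "variety_dim Y =
     (SUP k \<in> {k. \<exists>Z. (\<forall>i\<le>k. projective_variety (Z i) \<and> Z i \<subseteq> Y) \<and> (\<forall>i<k. Z i \<subset> Z (Suc i))}. enat k)"

definition gradient :: "('n::finite) cpoly \<Rightarrow> complex ^ 'n \<Rightarrow> complex ^ 'n" where
  "gradient p v = (\<chi> i. deriv (\<lambda>z. cpoly_eval p (\<chi> j. if j = i then z else v $ j)) (v $ i))"

text \<open>
  Jacobian criterion: at every point the rank of the Jacobian matrix of the homogeneous ideal of
  \<open>Y\<close> is the codimension of \<open>Y\<close> in the projective space, which has dimension \<open>CARD('n) - 1\<close>.
\<close>

definition smooth_projective_variety :: "(complex ^ 'n) set set \<Rightarrow> bool" where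
  "smooth_projective_variety Y \<longleftrightarrow> projective_variety Y \<and>
     (\<forall>L\<in>Y. \<forall>v\<in>L - {0}.
        enat (vec.dim {gradient p v |p. homogeneous p \<and> (\<forall>M\<in>Y. vanishes_at p M)})
          + variety_dim Y + 1 = enat CARD('n))"


section \<open>The associated analytic space and the exponential sequence\<close>

text \<open>The quotient topology of \<open>\<complex>\<^sup>n - {0}\<close>, \<open>n = CARD('n)\<close>.\<close>

definition proj_topology :: "(complex ^ 'n) set topology" where
  "proj_topology = topology (\<lambda>U. U \<subseteq> proj_space \<and> open {v. v \<noteq> 0 \<and> proj_point v \<in> U})"

lemma openin_proj_topology:
  fixes U :: "(complex ^ 'n) set set"
  shows "openin proj_topology U \<longleftrightarrow> U \<subseteq> proj_space \<and> open {v. v \<noteq> 0 \<and> proj_point v \<in> U}"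
proof -
  have "istopology (\<lambda>U::(complex ^ 'n) set set. U \<subseteq> proj_space \<and> open {v. v \<noteq> 0 \<and> proj_point v \<in> U})"
    unfolding istopology_def
  proof (intro conjI allI impI)
    fix S T :: "(complex ^ 'n) set set"
    assume "S \<subseteq> proj_space \<and> open {v. v \<noteq> 0 \<and> proj_point v \<in> S}"
      and "T \<subseteq> proj_space \<and> open {v. v \<noteq> 0 \<and> proj_point v \<in> T}"
    moreover have "{v. v \<noteq> 0 \<and> proj_point v \<in> S \<inter> T} =
        {v. v \<noteq> 0 \<and> proj_point v \<in> S} \<inter> {v. v \<noteq> 0 \<and> proj_point v \<in> T}" by auto
    ultimately show "S \<inter> T \<subseteq> proj_space" "open {v. v \<noteq> 0 \<and> proj_point v \<in> S \<inter> T}"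
      by (auto intro: open_Int)
  next
    fix \<K> :: "(complex ^ 'n) set set set"
    assume *: "\<forall>K\<in>\<K>. K \<subseteq> proj_space \<and> open {v. v \<noteq> 0 \<and> proj_point v \<in> K}"
    then show "\<Union>\<K> \<subseteq> proj_space" by auto
    have "{v. v \<noteq> 0 \<and> proj_point v \<in> \<Union>\<K>} = (\<Union>K\<in>\<K>. {v. v \<noteq> 0 \<and> proj_point v \<in> K})" by auto
    with * show "open {v. v \<noteq> 0 \<and> proj_point v \<in> \<Union>\<K>}" by auto
  qed
  then show ?thesis
    unfolding proj_topology_def by (simp add: topology_inverse')
qed

definition analytic_space :: "(complex ^ 'n) set set \<Rightarrow> (complex ^ 'n) set topology" where
  "analytic_space Y = subtopology proj_topology Y"

text \<open>
  A function on an open subset of projective space is holomorphic iff its pullback along the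
  submersion \<open>\<complex>\<^sup>n - {0} \<rightarrow> \<P>\<close> is, that is, iff the pullback has a complex linear derivative
  everywhere. Functions on \<open>Y\<close> are holomorphic iff they extend locally to holomorphic functions on
  the ambient projective space.
\<close>

definition proj_holomorphic :: "(complex ^ 'n) set set \<Rightarrow> ((complex ^ 'n) set \<Rightarrow> complex) \<Rightarrow> bool" where
  "proj_holomorphic W g \<longleftrightarrow>
     (\<forall>v. v \<noteq> 0 \<and> proj_point v \<in> W \<longrightarrow>
        (\<exists>D. ((\<lambda>w. g (proj_point w)) has_derivative D) (at v) \<and> (\<forall>c w. D (c *s w) = c * D w)))"

definition holomorphic_fun :: "(complex ^ 'n) set set \<Rightarrow> ((complex ^ 'n) set \<Rightarrow> complex) \<Rightarrow> bool" where
  "holomorphic_fun U f \<longleftrightarrow>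
     (\<forall>L\<in>U. \<exists>W g. openin proj_topology W \<and> L \<in> W \<and> proj_holomorphic W g \<and> (\<forall>M\<in>U \<inter> W. f M = g M))"

definition function_presheaf ::
  "'b monoid \<Rightarrow> ('x set \<Rightarrow> ('x \<Rightarrow> 'b) \<Rightarrow> bool) \<Rightarrow> ('x, 'x \<Rightarrow> 'b) presheaf" where
  "function_presheaf K P =
     \<lparr>sections = (\<lambda>U. (product_group U (\<lambda>_. K))\<lparr>carrier := {f \<in> U \<rightarrow>\<^sub>E carrier K. P U f}\<rparr>),
      restr = (\<lambda>U V f. restrict f V)\<rparr>"

definition complex_add_group :: "complex monoid" where
  "complex_add_group = \<lparr>carrier = UNIV, monoid.mult = (+), one = 0\<rparr>"

definition complex_mult_group :: "complex monoid" where
  "complex_mult_group = \<lparr>carrier = UNIV - {0}, monoid.mult = (*), one = 1\<rparr>"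

definition holomorphic_sheaf :: "((complex ^ 'n) set, (complex ^ 'n) set \<Rightarrow> complex) presheaf" where
  "holomorphic_sheaf = function_presheaf complex_add_group holomorphic_fun"

definition holomorphic_units_sheaf ::
  "((complex ^ 'n) set, (complex ^ 'n) set \<Rightarrow> complex) presheaf" where
  "holomorphic_units_sheaf = function_presheaf complex_mult_group holomorphic_fun"

text \<open>The constant sheaf, whose sections are the locally constant integer valued functions.\<close>

definition integer_sheaf :: "'x topology \<Rightarrow> ('x, 'x \<Rightarrow> int) presheaf" where
  "integer_sheaf X = function_presheaf integer_group
     (\<lambda>U f. \<forall>x\<in>U. \<exists>V. openin X V \<and> x \<in> V \<and> V \<subseteq> U \<and> (\<forall>y\<in>V. f y = f x))"

definition integer_inclusion :: "'x set \<Rightarrow> ('x \<Rightarrow> int) \<Rightarrow> 'x \<Rightarrow> complex" where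
  "integer_inclusion U f = (\<lambda>x\<in>U. of_int (f x))"

definition exponential_map :: "'x set \<Rightarrow> ('x \<Rightarrow> complex) \<Rightarrow> 'x \<Rightarrow> complex" where
  "exponential_map U f = (\<lambda>x\<in>U. exp (2 * of_real pi * \<i> * f x))"

definition exponential_boundary where
  "exponential_boundary Y =
     boundary2 (analytic_space Y)
       (integer_sheaf (analytic_space Y)) holomorphic_sheaf integer_inclusion
       holomorphic_units_sheaf exponential_map"

definition "Brauer_group Y = torsion_subgroup (sheaf_H2 (analytic_space Y) holomorphic_units_sheaf)"

end

theory Submission
  imports Defs
begin

text \<open>
  The presheaf cokernel \<open>Q\<close> of \<open>F \<rightarrow> C\<^sup>0(F)\<close> preserves stalkwise exactness, so the exponential sequence
  yields short exact sequences of Godement cochains and hence the exact sequence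
  \<open>H\<^sup>2(\<O>) \<rightarrow> H\<^sup>2(\<O>\<^sup>*) \<rightarrow> H\<^sup>3(\<int>) \<rightarrow> H\<^sup>3(\<O>)\<close>. The boundary map is injective because \<open>H\<^sup>2(\<O>)\<close> vanishes.
  Multiplication by \<open>n > 0\<close> is bijective on the sections of \<open>\<O>\<close>, hence on stalks, products of stalks,
  quotients, and so on all Godement cochains; therefore \<open>H\<^sup>3(\<O>)\<close> is torsion free and every torsion class of
  \<open>H\<^sup>3(\<int>)\<close> lies in the image, with torsion preimage by injectivity.
\<close>

section \<open>Quotients and uniquely divisible groups\<close>

text \<open>Two points shape the argument. The type of a cochain grows with its degree, so no
  complex here is a family indexed by degree. \<open>sheaf_H2\<close> is \<open>sheaf_H1\<close> of
  \<open>godement_quot\<close>; accordingly the work is done once, for the boundary map from degree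
  1 to degree 2, and the degree that is wanted results from replacing the sequence by its image
  under \<open>godement_quot\<close>. That quotient need not satisfy gluing. The class of sequences
  carried along must be closed under it: presheaves without a gluing axiom, with exactness only
  after shrinking the open set around a given point. Neither the full long exact sequence nor the
  third cohomology of the holomorphic sheaf is ever formed. In additive notation: if n kills the
  class of a cocycle a, then n a = d x. Dividing the image of x by n among the cochains of the
  middle term gives b, and cancelling n one degree higher shows that the image of a is d b. Hence
  the image of b is a cocycle whose class is sent to the class of a.\<close>

lemma (in comm_group) subgroup_comm_group:
  assumes H: "subgroup H G"
  shows "comm_group (G\<lparr>carrier := H\<rparr>)"
proof (rule group.group_comm_groupI)
  show "group (G\<lparr>carrier := H\<rparr>)" using subgroup.subgroup_is_group[OF H is_group] .
qed (use subgroup.mem_carrier[OF H] in \<open>auto simp: m_comm\<close>)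

lemma (in comm_group) rcos_eq_iff:
  assumes H: "subgroup H G" and x: "x \<in> carrier G" and y: "y \<in> carrier G"
  shows "H #> x = H #> y \<longleftrightarrow> (\<exists>h\<in>H. y = x \<otimes> h)"
proof
  assume "H #> x = H #> y"
  then have "y \<in> H #> x" using rcos_self[OF y H] by simp
  then obtain h where h: "h \<in> H" "y = h \<otimes> x" by (auto simp: r_coset_def)
  then show "\<exists>h\<in>H. y = x \<otimes> h"
    using subgroup.mem_carrier[OF H h(1)] x m_comm by blast
next
  assume "\<exists>h\<in>H. y = x \<otimes> h"
  then obtain h where h: "h \<in> H" "y = h \<otimes> x"
    using subgroup.mem_carrier[OF H] x by (auto simp: m_comm)
  then have "y \<in> H #> x" by (auto simp: r_coset_def)
  then show "H #> x = H #> y" using repr_independence x H by blast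
qed

lemma (in comm_group) rcos_eq_subgroup_iff:
  assumes H: "subgroup H G" and x: "x \<in> carrier G"
  shows "H #> x = H \<longleftrightarrow> x \<in> H"
  using coset_join1[OF _ x H] coset_join2[OF x H] by blast

lemma (in comm_group) mem_rcos_iff:
  assumes H: "subgroup H G" and x: "x \<in> carrier G"
  shows "y \<in> H #> x \<longleftrightarrow> (\<exists>h\<in>H. y = x \<otimes> h)"
  using subgroup.mem_carrier[OF H] x by (auto simp: r_coset_def m_comm)

lemma (in comm_group) rcos_in_FactGroup:
  "x \<in> carrier G \<Longrightarrow> H #> x \<in> carrier (G Mod H)"
  by (auto simp: carrier_FactGroup)

lemma (in comm_group) FactGroup_mult:
  assumes H: "subgroup H G" and "x \<in> carrier G" "y \<in> carrier G"
  shows "(H #> x) \<otimes>\<^bsub>G Mod H\<^esub> (H #> y) = H #> (x \<otimes> y)"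
  using normal.rcos_sum[OF subgroup_imp_normal[OF H]] assms by simp

lemma hom_m_inv:
  assumes "h \<in> hom G H" "group G" "group H" "x \<in> carrier G"
  shows "h (inv\<^bsub>G\<^esub> x) = inv\<^bsub>H\<^esub> h x"
  using assms by (intro group_hom.hom_inv) (auto simp: group_hom_def group_hom_axioms_def)

lemma (in comm_group) rcos_nat_pow:
  assumes "subgroup H G" "x \<in> carrier G"
  shows "(H #> x) [^]\<^bsub>G Mod H\<^esub> (n::nat) = H #> (x [^] n)"
  using assms by (simp add: normal.FactGroup_pow subgroup_imp_normal)

text \<open>Maps on quotients are given as unions over representatives, so only their values on
  cosets can be controlled. The map \<open>\<theta>\<close> of representatives supplies
  multiplicativity.\<close>

lemma hom_FactGroupI:
  assumes "comm_group G" "comm_group G'" "subgroup H G" "subgroup H' G'" "\<theta> \<in> hom G G'"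
    and \<Phi>: "\<And>x. x \<in> carrier G \<Longrightarrow> \<Phi> (H #>\<^bsub>G\<^esub> x) = H' #>\<^bsub>G'\<^esub> \<theta> x"
  shows "\<Phi> \<in> hom (G Mod H) (G' Mod H')"
proof -
  interpret G: comm_group G by fact
  interpret G': comm_group G' by fact
  show ?thesis
    using assms(5)
    by (auto simp: hom_def carrier_FactGroup G.FactGroup_mult[OF assms(3), simplified]
        G'.FactGroup_mult[OF assms(4), simplified] \<Phi> Pi_iff)
qed

text \<open>Two elements of one coset of \<open>H\<close> differ by an element of \<open>H\<close>,
  which \<open>\<theta>\<close> sends into \<open>H'\<close>. The union is thus over copies of a
  single coset. This makes restriction and functoriality of \<open>godement_quot\<close>
  computable.\<close>

lemma Union_rcos_eq:
  assumes "comm_group G" "comm_group G'" "subgroup H G" "subgroup H' G'" "\<theta> \<in> hom G G'"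
    and sub: "\<theta> ` H \<subseteq> H'" and x: "x \<in> carrier G"
  shows "(\<Union>f\<in>H #>\<^bsub>G\<^esub> x. H' #>\<^bsub>G'\<^esub> \<theta> f) = H' #>\<^bsub>G'\<^esub> \<theta> x"
proof (rule SUP_eq_const)
  interpret G: comm_group G by fact
  interpret G': comm_group G' by fact
  show "H #>\<^bsub>G\<^esub> x \<noteq> {}" using G.rcos_self[OF x assms(3)] by blast
  fix f assume "f \<in> H #>\<^bsub>G\<^esub> x"
  then obtain h where h: "h \<in> H" "f = x \<otimes>\<^bsub>G\<^esub> h"
    using G.mem_rcos_iff[OF assms(3) x] by blast
  have hG: "h \<in> carrier G" using h(1) assms(3) by (rule subgroup.mem_carrier[rotated])
  have "\<theta> f = \<theta> x \<otimes>\<^bsub>G'\<^esub> \<theta> h" using assms(5) x hG h(2) by (simp add: hom_mult)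
  moreover have "\<theta> h \<in> H'" using sub h(1) by blast
  ultimately show "H' #>\<^bsub>G'\<^esub> \<theta> f = H' #>\<^bsub>G'\<^esub> \<theta> x"
    using G'.rcos_eq_iff[OF assms(4), of "\<theta> x" "\<theta> f"] hom_in_carrier[OF assms(5)] x hG h(2)
    by (metis G.m_closed)
qed

text \<open>For a commutative group this says that it is a rational vector space, in multiplicative
  notation: the \<open>n\<close>-th power is multiplication by \<open>n\<close>.\<close>

definition uniquely_divisible :: "('a, 'b) monoid_scheme \<Rightarrow> bool" where
  "uniquely_divisible G \<longleftrightarrow>
     (\<forall>n::nat. n > 0 \<longrightarrow> bij_betw (\<lambda>x. x [^]\<^bsub>G\<^esub> n) (carrier G) (carrier G))"

lemma uniquely_divisibleI:
  fixes G (structure)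
  assumes "\<And>n x. n > 0 \<Longrightarrow> x \<in> carrier G \<Longrightarrow> \<exists>y\<in>carrier G. y [^] (n::nat) = x"
    and "\<And>n x. n > 0 \<Longrightarrow> x \<in> carrier G \<Longrightarrow> x [^] (n::nat) = \<one> \<Longrightarrow> x = \<one>"
    and "comm_group G"
  shows "uniquely_divisible G"
  unfolding uniquely_divisible_def bij_betw_def
proof (intro allI impI conjI)
  interpret comm_group G by fact
  fix n :: nat assume n: "n > 0"
  show "inj_on (\<lambda>x. x [^] n) (carrier G)"
  proof (rule inj_onI)
    fix x y assume xy: "x \<in> carrier G" "y \<in> carrier G" "x [^] n = y [^] n"
    then have "(x \<otimes> inv y) [^] n = \<one>"
      by (simp add: nat_pow_distrib nat_pow_inv)
    then have "x \<otimes> inv y = \<one>" using assms(2)[OF n] xy by simp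
    then show "x = y" using xy by (metis inv_equality inv_inv inv_closed)
  qed
  show "(\<lambda>x. x [^] n) ` carrier G = carrier G"
    using assms(1)[OF n] by (fastforce simp: image_iff)
qed

lemma uniquely_divisible_root:
  fixes G (structure)
  assumes "uniquely_divisible G" "n > 0" "x \<in> carrier G"
  obtains y where "y \<in> carrier G" "y [^] (n::nat) = x"
  using assms unfolding uniquely_divisible_def bij_betw_def
  by (metis (no_types, lifting) image_iff)

lemma uniquely_divisible_inj:
  fixes G (structure)
  assumes "uniquely_divisible G" "n > 0" "x \<in> carrier G" "y \<in> carrier G" "x [^] (n::nat) = y [^] n"
  shows "x = y"
  using assms unfolding uniquely_divisible_def bij_betw_def inj_on_def by metis

text \<open>Roots descend from \<open>G\<close>. For torsion, if the \<open>n\<close>-th power of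
  \<open>x\<close> lies in \<open>H\<close>, it also has a root inside \<open>H\<close>, and
  uniqueness of roots in \<open>G\<close> forces \<open>x\<close> to be that root.\<close>

lemma uniquely_divisible_FactGroup:
  assumes "comm_group G" "uniquely_divisible G" and H: "subgroup H G"
    and div: "\<And>n h. n > 0 \<Longrightarrow> h \<in> H \<Longrightarrow> \<exists>k\<in>H. k [^]\<^bsub>G\<^esub> (n::nat) = h"
  shows "uniquely_divisible (G Mod H)"
proof (rule uniquely_divisibleI)
  interpret comm_group G by fact
  show "comm_group (G Mod H)" using H by (rule abelian_FactGroup)
  fix n :: nat and S assume n: "n > 0" and S: "S \<in> carrier (G Mod H)"
  from S obtain x where x: "x \<in> carrier G" "S = H #>\<^bsub>G\<^esub> x" by (auto simp: carrier_FactGroup)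
  obtain y where "y \<in> carrier G" "y [^]\<^bsub>G\<^esub> n = x"
    using uniquely_divisible_root[OF assms(2) n x(1)] .
  then show "\<exists>T\<in>carrier (G Mod H). T [^]\<^bsub>G Mod H\<^esub> n = S"
    using rcos_nat_pow[OF H] rcos_in_FactGroup x by metis
  assume "S [^]\<^bsub>G Mod H\<^esub> n = \<one>\<^bsub>G Mod H\<^esub>"
  then have "x [^]\<^bsub>G\<^esub> n \<in> H"
    using rcos_nat_pow[OF H] rcos_eq_subgroup_iff[OF H] x by auto
  then obtain h where "h \<in> H" "h [^]\<^bsub>G\<^esub> n = x [^]\<^bsub>G\<^esub> n"
    using div[OF n] by blast
  then have "x \<in> H"
    using uniquely_divisible_inj[OF assms(2) n] x(1) subgroup.mem_carrier[OF H] by metis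
  then show "S = \<one>\<^bsub>G Mod H\<^esub>" using rcos_eq_subgroup_iff[OF H x(1)] x(2) by simp
qed

lemma product_group_nat_pow:
  "f [^]\<^bsub>product_group I G\<^esub> (n::nat) = (\<lambda>i\<in>I. f i [^]\<^bsub>G i\<^esub> n)"
  by (induction n) (simp_all add: fun_eq_iff)

lemma comm_group_product_group:
  assumes "\<And>i. i \<in> I \<Longrightarrow> comm_group (G i)"
  shows "comm_group (product_group I G)"
proof (rule group.group_comm_groupI)
  show "group (product_group I G)" using assms by (simp add: comm_group.axioms)
  fix x y assume "x \<in> carrier (product_group I G)" "y \<in> carrier (product_group I G)"
  then show "x \<otimes>\<^bsub>product_group I G\<^esub> y = y \<otimes>\<^bsub>product_group I G\<^esub> x"
    using assms by (auto simp: fun_eq_iff restrict_def PiE_iff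
        intro!: comm_monoid.m_comm comm_group.axioms(1))
qed

section \<open>The connecting homomorphism\<close>

text \<open>The terms of a complex have different types, so they are passed one by one; this is the
  cohomology at the middle term \<open>K1\<close>.\<close>

definition cohomology where
  "cohomology K0 d0 K1 d1 K2 = (K1\<lparr>carrier := kernel K1 K2 d1\<rparr>) Mod (d0 ` carrier K0)"

locale three_term_complex = K0: comm_group K0 + K1: comm_group K1 + K2: comm_group K2
  for K0 (structure) and K1 (structure) and K2 (structure) +
  fixes d0 d1
  assumes d0_hom: "d0 \<in> hom K0 K1" and d1_hom: "d1 \<in> hom K1 K2"
    and dd: "x \<in> carrier K0 \<Longrightarrow> d1 (d0 x) = \<one>\<^bsub>K2\<^esub>"
begin

abbreviation "cocycles \<equiv> K1\<lparr>carrier := kernel K1 K2 d1\<rparr>"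
abbreviation "cls x \<equiv> d0 ` carrier K0 #>\<^bsub>K1\<^esub> x"

lemma kernel_subgroup: "subgroup (kernel K1 K2 d1) K1"
  using d1_hom K1.is_group K2.is_group
  by (intro group_hom.subgroup_kernel) (auto simp: group_hom_def group_hom_axioms_def)

lemma cocycles_comm_group: "comm_group cocycles"
  by (rule K1.subgroup_comm_group[OF kernel_subgroup])

lemma image_subset_kernel: "d0 ` carrier K0 \<subseteq> kernel K1 K2 d1"
  using hom_in_carrier[OF d0_hom] dd by (auto simp: kernel_def)

lemma image_subgroup: "subgroup (d0 ` carrier K0) K1"
  using d0_hom K0.is_group K1.is_group
  by (intro group_hom.img_is_subgroup) (auto simp: group_hom_def group_hom_axioms_def)

lemma image_subgroup_cocycles: "subgroup (d0 ` carrier K0) cocycles"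
  using K1.subgroup_incl[OF image_subgroup kernel_subgroup image_subset_kernel] .

lemma cohomology_comm_group: "comm_group (cohomology K0 d0 K1 d1 K2)"
  unfolding cohomology_def
  by (rule comm_group.abelian_FactGroup[OF cocycles_comm_group image_subgroup_cocycles])

lemma cohomology_carrier: "carrier (cohomology K0 d0 K1 d1 K2) = cls ` kernel K1 K2 d1"
  by (simp add: cohomology_def carrier_FactGroup)

lemma cohomology_one: "\<one>\<^bsub>cohomology K0 d0 K1 d1 K2\<^esub> = d0 ` carrier K0"
  by (simp add: cohomology_def)

lemma cohomology_mult:
  assumes "x \<in> kernel K1 K2 d1" "y \<in> kernel K1 K2 d1"
  shows "cls x \<otimes>\<^bsub>cohomology K0 d0 K1 d1 K2\<^esub> cls y = cls (x \<otimes>\<^bsub>K1\<^esub> y)"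
  using comm_group.FactGroup_mult[OF cocycles_comm_group image_subgroup_cocycles, of x y] assms
  by (simp add: cohomology_def)

lemma cohomology_pow:
  assumes "x \<in> kernel K1 K2 d1"
  shows "cls x [^]\<^bsub>cohomology K0 d0 K1 d1 K2\<^esub> (n::nat) = cls (x [^]\<^bsub>K1\<^esub> n)"
  using comm_group.rcos_nat_pow[OF cocycles_comm_group image_subgroup_cocycles, of x n] assms
  by (simp add: cohomology_def flip: K1.nat_pow_consistent)

lemma cls_eq_iff:
  assumes "x \<in> carrier K1" "y \<in> carrier K1"
  shows "cls x = cls y \<longleftrightarrow> (\<exists>k\<in>carrier K0. y = x \<otimes>\<^bsub>K1\<^esub> d0 k)"
  using K1.rcos_eq_iff[OF image_subgroup assms] by auto

lemma cls_eq_one_iff: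
  assumes "x \<in> carrier K1"
  shows "cls x = d0 ` carrier K0 \<longleftrightarrow> x \<in> d0 ` carrier K0"
  by (rule K1.rcos_eq_subgroup_iff[OF image_subgroup assms])

end

section \<open>Short exact sequences of complexes and the zigzag\<close>

locale short_exact_groups = A: comm_group A + B: comm_group B + C: comm_group C
  for A (structure) and B (structure) and C (structure) +
  fixes \<phi> \<psi>
  assumes \<phi>_hom: "\<phi> \<in> hom A B" and \<psi>_hom: "\<psi> \<in> hom B C"
    and \<phi>_inj: "inj_on \<phi> (carrier A)"
    and exact: "kernel B C \<psi> = \<phi> ` carrier A"
    and \<psi>_surj: "\<psi> ` carrier B = carrier C"

text \<open>The zigzag runs from degree 1 of \<open>C\<close> to degree 2 of \<open>A\<close>.
  Degree 0 is there to compare representatives of a class of \<open>HC\<close>, and degree 3 to see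
  that the resulting element of \<open>A2\<close> is a cocycle.\<close>

locale short_exact_complexes =
  S0: short_exact_groups A0 B0 C0 \<phi>0 \<psi>0 + S1: short_exact_groups A1 B1 C1 \<phi>1 \<psi>1 +
  S2: short_exact_groups A2 B2 C2 \<phi>2 \<psi>2 + S3: short_exact_groups A3 B3 C3 \<phi>3 \<psi>3 +
  A: three_term_complex A1 A2 A3 dA1 dA2 +
  B: three_term_complex B0 B1 B2 dB0 dB1 + B': three_term_complex B1 B2 B3 dB1 dB2 +
  C: three_term_complex C0 C1 C2 dC0 dC1
  for A0 A1 A2 A3 B0 B1 B2 B3 C0 C1 C2 C3 \<phi>0 \<phi>1 \<phi>2 \<phi>3 \<psi>0 \<psi>1 \<psi>2 \<psi>3
    dA1 dA2 dB0 dB1 dB2 dC0 dC1 +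
  assumes \<phi>1_comm: "\<And>x. x \<in> carrier A1 \<Longrightarrow> \<phi>2 (dA1 x) = dB1 (\<phi>1 x)"
    and \<phi>2_comm: "\<And>x. x \<in> carrier A2 \<Longrightarrow> \<phi>3 (dA2 x) = dB2 (\<phi>2 x)"
    and \<psi>0_comm: "\<And>y. y \<in> carrier B0 \<Longrightarrow> \<psi>1 (dB0 y) = dC0 (\<psi>0 y)"
    and \<psi>1_comm: "\<And>y. y \<in> carrier B1 \<Longrightarrow> \<psi>2 (dB1 y) = dC1 (\<psi>1 y)"
begin

abbreviation "HB \<equiv> cohomology B0 dB0 B1 dB1 B2"
abbreviation "HC \<equiv> cohomology C0 dC0 C1 dC1 C2"
abbreviation "HA \<equiv> cohomology A1 dA1 A2 dA2 A3"

definition lifts :: "_ \<Rightarrow> _ \<Rightarrow> _ \<Rightarrow> bool" where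
  "lifts c b a \<longleftrightarrow> b \<in> carrier B1 \<and> a \<in> kernel A2 A3 dA2 \<and> \<psi>1 b = c \<and> \<phi>2 a = dB1 b"

text \<open>The shape copies \<open>boundary1\<close>, so that the two agree by unfolding once the
  Godement cochains are inserted.\<close>

definition connecting where
  "connecting \<xi> = (THE \<eta>. \<exists>b\<in>carrier B1. \<exists>a\<in>kernel A2 A3 dA2.
     \<psi>1 b \<in> \<xi> \<and> \<phi>2 a = dB1 b \<and> \<eta> = A.cls a)"

lemmas closed [simp] =
  hom_in_carrier[OF S0.\<phi>_hom] hom_in_carrier[OF S1.\<phi>_hom]
  hom_in_carrier[OF S2.\<phi>_hom] hom_in_carrier[OF S3.\<phi>_hom]
  hom_in_carrier[OF S0.\<psi>_hom] hom_in_carrier[OF S1.\<psi>_hom]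
  hom_in_carrier[OF S2.\<psi>_hom] hom_in_carrier[OF S3.\<psi>_hom]
  hom_in_carrier[OF A.d0_hom] hom_in_carrier[OF A.d1_hom]
  hom_in_carrier[OF B.d0_hom] hom_in_carrier[OF B.d1_hom] hom_in_carrier[OF B'.d1_hom]
  hom_in_carrier[OF C.d0_hom] hom_in_carrier[OF C.d1_hom]

lemmas mult =
  hom_mult[OF S1.\<phi>_hom] hom_mult[OF S2.\<phi>_hom] hom_mult[OF S0.\<psi>_hom] hom_mult[OF S1.\<psi>_hom]
  hom_mult[OF A.d0_hom] hom_mult[OF A.d1_hom]
  hom_mult[OF B.d0_hom] hom_mult[OF B.d1_hom] hom_mult[OF C.d0_hom] hom_mult[OF C.d1_hom]

lemma in_image_if_\<psi>_one:
  "y \<in> carrier B1 \<Longrightarrow> \<psi>1 y = \<one>\<^bsub>C1\<^esub> \<Longrightarrow> \<exists>x\<in>carrier A1. y = \<phi>1 x"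
  "y' \<in> carrier B2 \<Longrightarrow> \<psi>2 y' = \<one>\<^bsub>C2\<^esub> \<Longrightarrow> \<exists>x'\<in>carrier A2. y' = \<phi>2 x'"
  using S1.exact S2.exact by (auto simp: kernel_def)

lemma \<psi>_\<phi>:
  "x \<in> carrier A1 \<Longrightarrow> \<psi>1 (\<phi>1 x) = \<one>\<^bsub>C1\<^esub>" "x' \<in> carrier A2 \<Longrightarrow> \<psi>2 (\<phi>2 x') = \<one>\<^bsub>C2\<^esub>"
  using S1.exact S2.exact by (auto simp: kernel_def)

text \<open>As \<open>c\<close> is a cocycle, \<open>\<psi>2\<close> kills \<open>dB1 b\<close>, so
  exactness in degree 2 gives \<open>a\<close>. Its differential becomes trivial under
  \<open>\<phi>3\<close> because it turns into a double differential of \<open>b\<close>;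
  injectivity of \<open>\<phi>3\<close> finishes.\<close>

lemma lifts_exist:
  assumes "c \<in> kernel C1 C2 dC1"
  obtains b a where "lifts c b a"
proof -
  from assms have c: "c \<in> carrier C1" "dC1 c = \<one>\<^bsub>C2\<^esub>" by (auto simp: kernel_def)
  then obtain b where b: "b \<in> carrier B1" "\<psi>1 b = c"
    using S1.\<psi>_surj by (metis imageE)
  then obtain a where a: "a \<in> carrier A2" "dB1 b = \<phi>2 a"
    using in_image_if_\<psi>_one(2)[of "dB1 b"] \<psi>1_comm c by auto
  have "\<phi>3 (dA2 a) = \<phi>3 \<one>\<^bsub>A3\<^esub>"
    using \<phi>2_comm a b B'.dd hom_one[OF S3.\<phi>_hom S3.A.is_group S3.B.is_group] by metis
  then have "dA2 a = \<one>\<^bsub>A3\<^esub>" using S3.\<phi>_inj a by (auto simp: inj_on_def)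
  with a b have "lifts c b a" by (simp add: lifts_def kernel_def)
  then show thesis by (rule that)
qed

text \<open>The cocycles differ by \<open>dC0 k\<close>. Lifting \<open>k\<close> to
  \<open>m\<close> and multiplying \<open>b\<close> by \<open>dB0 m\<close> gives a lift of
  \<open>c'\<close> with the same differential as \<open>b\<close>. Two lifts of \<open>c'\<close>
  differ by some \<open>\<phi>1 x\<close>, and this changes \<open>a\<close> exactly by the
  coboundary \<open>dA1 x\<close>.\<close>

lemma lifts_unique:
  assumes l: "lifts c b a" and l': "lifts c' b' a'" and "C.cls c = C.cls c'"
  shows "A.cls a = A.cls a'"
proof -
  from l l' have b: "b \<in> carrier B1" "b' \<in> carrier B1" and a: "a \<in> carrier A2" "a' \<in> carrier A2"
    and eq: "\<psi>1 b = c" "\<psi>1 b' = c'" "\<phi>2 a = dB1 b" "\<phi>2 a' = dB1 b'"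
    by (auto simp: lifts_def kernel_def)
  then obtain k where k: "k \<in> carrier C0" "c' = c \<otimes>\<^bsub>C1\<^esub> dC0 k"
    using C.cls_eq_iff[of c c'] \<open>C.cls c = C.cls c'\<close> by auto
  then obtain m where m: "m \<in> carrier B0" "\<psi>0 m = k" using S0.\<psi>_surj by (metis imageE)
  let ?b = "b \<otimes>\<^bsub>B1\<^esub> dB0 m"
  have c': "c' \<in> carrier C1" using b eq by auto
  have "\<psi>1 ?b = c'" using m b eq k \<psi>0_comm by (simp add: mult)
  then have "\<psi>1 (inv\<^bsub>B1\<^esub> ?b \<otimes>\<^bsub>B1\<^esub> b') = \<one>\<^bsub>C1\<^esub>"
    using b m c' eq hom_m_inv[OF S1.\<psi>_hom S1.B.is_group S1.C.is_group, of ?b]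
    by (simp add: mult S1.C.l_inv S1.B.m_closed)
  then obtain x where x: "x \<in> carrier A1" "inv\<^bsub>B1\<^esub> ?b \<otimes>\<^bsub>B1\<^esub> b' = \<phi>1 x"
    using in_image_if_\<psi>_one(1)[of "inv\<^bsub>B1\<^esub> ?b \<otimes>\<^bsub>B1\<^esub> b'"] b m by auto
  then have b': "b' = ?b \<otimes>\<^bsub>B1\<^esub> \<phi>1 x"
    using S1.B.inv_solve_left'[of "\<phi>1 x" ?b b'] b m x by simp
  have "dB1 b' = dB1 b \<otimes>\<^bsub>B2\<^esub> dB1 (\<phi>1 x)"
    unfolding b' using b m x B.dd by (simp add: mult)
  then have "\<phi>2 a' = \<phi>2 (a \<otimes>\<^bsub>A2\<^esub> dA1 x)"
    using eq a x \<phi>1_comm by (simp add: mult)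
  then have "a' = a \<otimes>\<^bsub>A2\<^esub> dA1 x" using S2.\<phi>_inj a x by (auto simp: inj_on_def)
  then show ?thesis using A.cls_eq_iff[of a a'] a x by blast
qed

text \<open>The definite description ranges over all representatives of the class and all their
  lifts; \<open>lifts_unique\<close> says that they yield one value.\<close>

lemma connecting_eq:
  assumes "lifts c b a"
  shows "connecting (C.cls c) = A.cls a"
  unfolding connecting_def
proof (rule the_equality)
  from assms have b: "b \<in> carrier B1" "\<psi>1 b = c" by (auto simp: lifts_def)
  then have c: "c \<in> carrier C1" by auto
  have "c \<in> C.cls c" using S1.C.rcos_self[OF c C.image_subgroup] .
  then show "\<exists>b\<in>carrier B1. \<exists>a'\<in>kernel A2 A3 dA2.
      \<psi>1 b \<in> C.cls c \<and> \<phi>2 a' = dB1 b \<and> A.cls a = A.cls a'"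
    using assms by (auto simp: lifts_def)
  fix \<eta> assume "\<exists>b\<in>carrier B1. \<exists>a'\<in>kernel A2 A3 dA2.
      \<psi>1 b \<in> C.cls c \<and> \<phi>2 a' = dB1 b \<and> \<eta> = A.cls a'"
  then obtain b' a' where l: "lifts (\<psi>1 b') b' a'" "\<psi>1 b' \<in> C.cls c" "\<eta> = A.cls a'"
    by (auto simp: lifts_def)
  have "C.cls c = C.cls (\<psi>1 b')"
    using S1.C.repr_independence[OF l(2) c C.image_subgroup] .
  then show "\<eta> = A.cls a" using lifts_unique[OF assms l(1)] l(3) by simp
qed

lemma lifts_mult:
  assumes "lifts c b a" "lifts c' b' a'"
  shows "lifts (c \<otimes>\<^bsub>C1\<^esub> c') (b \<otimes>\<^bsub>B1\<^esub> b') (a \<otimes>\<^bsub>A2\<^esub> a')"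
  using assms by (auto simp: lifts_def kernel_def mult)

lemma connecting_hom: "connecting \<in> hom HC HA"
proof (rule homI)
  fix \<xi> assume "\<xi> \<in> carrier HC"
  then obtain c where c: "c \<in> kernel C1 C2 dC1" "\<xi> = C.cls c" by (auto simp: C.cohomology_carrier)
  obtain b a where l: "lifts c b a" using lifts_exist[OF c(1)] .
  then show "connecting \<xi> \<in> carrier HA"
    by (simp add: c connecting_eq A.cohomology_carrier) (simp add: lifts_def)
  fix \<xi>' assume "\<xi>' \<in> carrier HC"
  then obtain c' where c': "c' \<in> kernel C1 C2 dC1" "\<xi>' = C.cls c'" by (auto simp: C.cohomology_carrier)
  obtain b' a' where l': "lifts c' b' a'" using lifts_exist[OF c'(1)] .
  have "a \<in> kernel A2 A3 dA2" "a' \<in> kernel A2 A3 dA2" using l l' by (auto simp: lifts_def)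
  then show "connecting (\<xi> \<otimes>\<^bsub>HC\<^esub> \<xi>') = connecting \<xi> \<otimes>\<^bsub>HA\<^esub> connecting \<xi>'"
    by (simp add: c c' C.cohomology_mult A.cohomology_mult connecting_eq[OF l] connecting_eq[OF l']
        connecting_eq[OF lifts_mult[OF l l']])
qed

text \<open>If \<open>a\<close> is the coboundary of \<open>x\<close>, then dividing
  \<open>b\<close> by \<open>\<phi>1 x\<close> turns it into a cocycle still lying over
  \<open>c\<close>. Triviality of \<open>HB\<close> makes it a coboundary, and its image
  \<open>c\<close> is then one as well.\<close>

lemma connecting_one_imp:
  assumes triv: "trivial_group HB" and \<xi>: "\<xi> \<in> carrier HC" "connecting \<xi> = \<one>\<^bsub>HA\<^esub>"
  shows "\<xi> = \<one>\<^bsub>HC\<^esub>"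
proof -
  from \<xi>(1) obtain c where c: "c \<in> kernel C1 C2 dC1" "\<xi> = C.cls c"
    by (auto simp: C.cohomology_carrier)
  obtain b a where l: "lifts c b a" using lifts_exist[OF c(1)] .
  then have b: "b \<in> carrier B1" "a \<in> carrier A2" "\<psi>1 b = c" "\<phi>2 a = dB1 b"
    by (auto simp: lifts_def kernel_def)
  have "A.cls a = dA1 ` carrier A1"
    using \<xi>(2) by (simp add: c connecting_eq[OF l] A.cohomology_one)
  then obtain x where x: "x \<in> carrier A1" "a = dA1 x"
    using A.cls_eq_one_iff[OF b(2)] by blast
  let ?b = "b \<otimes>\<^bsub>B1\<^esub> inv\<^bsub>B1\<^esub> \<phi>1 x"
  have "dB1 ?b = \<one>\<^bsub>B2\<^esub>"
    using hom_m_inv[OF B.d1_hom S1.B.is_group S2.B.is_group, of "\<phi>1 x"] b x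
    by (simp add: mult \<phi>1_comm S2.B.r_inv)
  then have "?b \<in> kernel B1 B2 dB1" using b x by (simp add: kernel_def)
  then have "B.cls ?b = \<one>\<^bsub>HB\<^esub>"
    using triv by (auto simp: trivial_group_def B.cohomology_carrier)
  then obtain m where m: "m \<in> carrier B0" "?b = dB0 m"
    using B.cls_eq_one_iff[of ?b] b x by (auto simp: B.cohomology_one)
  have "c = \<psi>1 ?b"
    using hom_m_inv[OF S1.\<psi>_hom S1.B.is_group S1.C.is_group, of "\<phi>1 x"] b x
    by (auto simp add: mult \<psi>_\<phi>)
  also have "\<dots> = dC0 (\<psi>0 m)" using m \<psi>0_comm by simp
  finally have "c \<in> dC0 ` carrier C0" using m by auto
  then show ?thesis
    using C.cls_eq_one_iff[of c] c by (auto simp: C.cohomology_one kernel_def)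
qed

lemma connecting_torsion_iso:
  assumes triv: "trivial_group HB" and div: "uniquely_divisible B1" "uniquely_divisible B2"
  shows "connecting \<in> iso (torsion_subgroup HC) (torsion_subgroup HA)"
proof -
  interpret HA: comm_group HA by (rule A.cohomology_comm_group)
  interpret HC: comm_group HC by (rule C.cohomology_comm_group)
  note pow = hom_nat_pow[OF connecting_hom _ HC.is_group HA.is_group]
  have one: "connecting \<one>\<^bsub>HC\<^esub> = \<one>\<^bsub>HA\<^esub>"
    using hom_one[OF connecting_hom HC.is_group HA.is_group] .
  have inj: "inj_on connecting (carrier HC)"
  proof (rule inj_onI)
    fix x y assume xy: "x \<in> carrier HC" "y \<in> carrier HC" "connecting x = connecting y"
    then have "connecting (x \<otimes>\<^bsub>HC\<^esub> inv\<^bsub>HC\<^esub> y) = \<one>\<^bsub>HA\<^esub>"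
      by (simp add: hom_mult[OF connecting_hom] hom_in_carrier[OF connecting_hom]
          hom_m_inv[OF connecting_hom HC.is_group HA.is_group])
    then have "x \<otimes>\<^bsub>HC\<^esub> inv\<^bsub>HC\<^esub> y = \<one>\<^bsub>HC\<^esub>" using connecting_one_imp[OF triv] xy by simp
    then show "x = y" using xy by (metis HC.inv_equality HC.inv_inv HC.inv_closed)
  qed
  have surj: "\<exists>\<xi>\<in>carrier HC. connecting \<xi> = \<eta>"
    if \<eta>: "\<eta> \<in> carrier HA" "n > 0" "\<eta> [^]\<^bsub>HA\<^esub> n = \<one>\<^bsub>HA\<^esub>" for \<eta> and n :: nat
  proof -
    from \<eta>(1) obtain a where a: "a \<in> kernel A2 A3 dA2" "\<eta> = A.cls a"
      by (auto simp: A.cohomology_carrier)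
    then have aA: "a \<in> carrier A2" by (simp add: kernel_def)
    have "A.cls (a [^]\<^bsub>A2\<^esub> n) = dA1 ` carrier A1"
      using \<eta>(3) by (simp add: a A.cohomology_pow A.cohomology_one)
    then obtain x where x: "x \<in> carrier A1" "a [^]\<^bsub>A2\<^esub> n = dA1 x"
      using A.cls_eq_one_iff[of "a [^]\<^bsub>A2\<^esub> n"] aA by auto
    \<comment> \<open>The only place where roots are extracted: \<open>x\<close> itself need not
      have an \<open>n\<close>-th root in \<open>A1\<close>, but its image in \<open>B1\<close>
      does.\<close>
    obtain b where b: "b \<in> carrier B1" "b [^]\<^bsub>B1\<^esub> n = \<phi>1 x"
      using uniquely_divisible_root[OF div(1) \<open>n > 0\<close>, of "\<phi>1 x"] x by auto
    have "\<phi>2 a [^]\<^bsub>B2\<^esub> n = \<phi>2 (dA1 x)"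
      using hom_nat_pow[OF S2.\<phi>_hom aA S2.A.is_group S2.B.is_group, of n] x by simp
    also have "\<dots> = dB1 b [^]\<^bsub>B2\<^esub> n"
      using hom_nat_pow[OF B.d1_hom b(1) S1.B.is_group S2.B.is_group, of n] \<phi>1_comm x b by simp
    \<comment> \<open>Both sides have the same \<open>n\<close>-th power in \<open>B2\<close>, so
      uniqueness of roots there removes the exponent.\<close>
    finally have eq: "\<phi>2 a = dB1 b"
      using uniquely_divisible_inj[OF div(2) \<open>n > 0\<close>] aA b by simp
    then have "lifts (\<psi>1 b) b a" using a b by (simp add: lifts_def)
    moreover have "\<psi>1 b \<in> kernel C1 C2 dC1"
      using b \<psi>_\<phi>(2)[OF aA] eq by (simp add: kernel_def flip: \<psi>1_comm)
    ultimately show ?thesis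
      using connecting_eq[of "\<psi>1 b" b a] a by (auto simp: C.cohomology_carrier intro!: bexI[of _ "\<psi>1 b"])
  qed
  have "connecting ` carrier (torsion_subgroup HC) = carrier (torsion_subgroup HA)"
  proof (intro equalityI subsetI)
    fix \<eta> assume "\<eta> \<in> connecting ` carrier (torsion_subgroup HC)"
    then obtain \<xi> and n :: nat where \<xi>: "\<xi> \<in> carrier HC" "\<eta> = connecting \<xi>"
      and n: "n > 0" "\<xi> [^]\<^bsub>HC\<^esub> n = \<one>\<^bsub>HC\<^esub>" by (auto simp: torsion_subgroup_def)
    have "\<eta> [^]\<^bsub>HA\<^esub> n = \<one>\<^bsub>HA\<^esub>" using pow[OF \<xi>(1), of n] \<xi> n one by simp
    then show "\<eta> \<in> carrier (torsion_subgroup HA)"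
      using n(1) \<xi> hom_in_carrier[OF connecting_hom \<xi>(1)] by (auto simp: torsion_subgroup_def)
  next
    fix \<eta> assume "\<eta> \<in> carrier (torsion_subgroup HA)"
    then obtain n :: nat where n: "n > 0" "\<eta> \<in> carrier HA" "\<eta> [^]\<^bsub>HA\<^esub> n = \<one>\<^bsub>HA\<^esub>"
      by (auto simp: torsion_subgroup_def)
    then obtain \<xi> where \<xi>: "\<xi> \<in> carrier HC" "connecting \<xi> = \<eta>" using surj by blast
    \<comment> \<open>The power is sent to the identity, hence is trivial by injectivity; a preimage
      of a torsion class is torsion with the same exponent.\<close>
    have "\<xi> [^]\<^bsub>HC\<^esub> n = \<one>\<^bsub>HC\<^esub>" using connecting_one_imp[OF triv] \<xi> n pow by simp
    then show "\<eta> \<in> connecting ` carrier (torsion_subgroup HC)"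
      using \<xi> n by (auto simp: torsion_subgroup_def)
  qed
  moreover have "inj_on connecting (carrier (torsion_subgroup HC))"
    using inj by (rule inj_on_subset) (auto simp: torsion_subgroup_def)
  ultimately have bij: "bij_betw connecting (carrier (torsion_subgroup HC)) (carrier (torsion_subgroup HA))"
    by (simp add: bij_betw_def)
  moreover have "connecting \<in> hom (torsion_subgroup HC) (torsion_subgroup HA)"
  proof (rule homI)
    show "connecting \<xi> \<in> carrier (torsion_subgroup HA)"
      if "\<xi> \<in> carrier (torsion_subgroup HC)" for \<xi>
      using bij that by (auto simp: bij_betw_def)
  qed (auto simp: torsion_subgroup_def hom_mult[OF connecting_hom])
  ultimately show ?thesis by (simp add: iso_def)
qed

end

section \<open>Germs and stalks\<close>

text \<open>There is no gluing axiom, since the notion has to be inherited by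
  \<open>godement_quot\<close>, a presheaf cokernel.\<close>

locale abelian_presheaf =
  fixes X :: "'x topology" and F :: "('x, 'a) presheaf"
  assumes sections_comm_group: "openin X U \<Longrightarrow> comm_group (sections F U)"
    and restr_hom: "openin X U \<Longrightarrow> openin X V \<Longrightarrow> V \<subseteq> U \<Longrightarrow>
      restr F U V \<in> hom (sections F U) (sections F V)"
    and restr_id: "openin X U \<Longrightarrow> s \<in> carrier (sections F U) \<Longrightarrow> restr F U U s = s"
    and restr_restr: "openin X U \<Longrightarrow> openin X V \<Longrightarrow> openin X W \<Longrightarrow> W \<subseteq> V \<Longrightarrow> V \<subseteq> U \<Longrightarrow>
      s \<in> carrier (sections F U) \<Longrightarrow> restr F V W (restr F U V s) = restr F U W s"
begin

lemma sections_group: "openin X U \<Longrightarrow> group (sections F U)"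
  using sections_comm_group by (rule comm_group.axioms)

lemma sections_mult_closed:
  "openin X U \<Longrightarrow> s \<in> carrier (sections F U) \<Longrightarrow> t \<in> carrier (sections F U) \<Longrightarrow>
    s \<otimes>\<^bsub>sections F U\<^esub> t \<in> carrier (sections F U)"
  by (simp add: sections_group group.is_monoid monoid.m_closed)

lemma sections_one_closed: "openin X U \<Longrightarrow> \<one>\<^bsub>sections F U\<^esub> \<in> carrier (sections F U)"
  by (simp add: sections_group group.is_monoid monoid.one_closed)

lemma restr_closed:
  "openin X U \<Longrightarrow> openin X V \<Longrightarrow> V \<subseteq> U \<Longrightarrow> s \<in> carrier (sections F U) \<Longrightarrow>
    restr F U V s \<in> carrier (sections F V)"
  using restr_hom by (rule hom_in_carrier)

lemma restr_mult:
  "openin X U \<Longrightarrow> openin X V \<Longrightarrow> V \<subseteq> U \<Longrightarrow>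
    s \<in> carrier (sections F U) \<Longrightarrow> t \<in> carrier (sections F U) \<Longrightarrow>
    restr F U V (s \<otimes>\<^bsub>sections F U\<^esub> t) = restr F U V s \<otimes>\<^bsub>sections F V\<^esub> restr F U V t"
  using restr_hom by (rule hom_mult)

lemma restr_one:
  "openin X U \<Longrightarrow> openin X V \<Longrightarrow> V \<subseteq> U \<Longrightarrow> restr F U V \<one>\<^bsub>sections F U\<^esub> = \<one>\<^bsub>sections F V\<^esub>"
  using restr_hom sections_group by (intro hom_one)

text \<open>A germ is the set of all pairs that agree with the given one near \<open>x\<close>, so
  the content is transitivity: agreement on \<open>M\<close> and on \<open>W\<close> gives agreement
  on \<open>M \<inter> W\<close>. One inclusion is shown for arbitrary data and then used in both
  directions.\<close>

lemma germ_eqI: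
  assumes U: "openin X U" "x \<in> U" "s \<in> carrier (sections F U)"
    and V: "openin X V" "x \<in> V" "t \<in> carrier (sections F V)"
    and W: "openin X W" "x \<in> W" "W \<subseteq> U \<inter> V" and eq: "restr F U W s = restr F V W t"
  shows "germ X F x U s = germ X F x V t"
proof -
  have sub: "germ X F x U s \<subseteq> germ X F x V t"
    if U: "openin X U" "x \<in> U" "s \<in> carrier (sections F U)"
      and V: "openin X V" "x \<in> V" "t \<in> carrier (sections F V)"
      and W: "openin X W" "x \<in> W" "W \<subseteq> U \<inter> V" and eq: "restr F U W s = restr F V W t" for U V s t
  proof (rule subrelI)
    fix N r assume "(N, r) \<in> germ X F x U s"
    then obtain M where N: "openin X N" "x \<in> N" "r \<in> carrier (sections F N)"
      and M: "openin X M" "x \<in> M" "M \<subseteq> U \<inter> N" "restr F U M s = restr F N M r"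
      by (auto simp: germ_def)
    have o: "openin X (M \<inter> W)" using M W by blast
    have "restr F V (M \<inter> W) t = restr F W (M \<inter> W) (restr F V W t)"
      using restr_restr[OF V(1) W(1) o _ _ V(3)] W by auto
    also have "\<dots> = restr F U (M \<inter> W) s"
      using restr_restr[OF U(1) W(1) o _ _ U(3)] W eq by auto
    also have "\<dots> = restr F M (M \<inter> W) (restr F U M s)"
      using restr_restr[OF U(1) M(1) o _ _ U(3)] M by auto
    also have "\<dots> = restr F N (M \<inter> W) r"
      using restr_restr[OF N(1) M(1) o _ _ N(3)] M by auto
    finally show "(N, r) \<in> germ X F x V t"
      using N M W o unfolding germ_def by blast
  qed
  show ?thesis
    using sub[OF U V W eq] sub[OF V U W(1,2) _ eq[symmetric]] W(3) by blast
qed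

lemma germ_self:
  assumes "openin X U" "x \<in> U" "s \<in> carrier (sections F U)"
  shows "(U, s) \<in> germ X F x U s"
  using assms unfolding germ_def by blast

lemma mem_germ_iff:
  assumes U: "openin X U" "x \<in> U" "s \<in> carrier (sections F U)"
  shows "(V, t) \<in> germ X F x U s \<longleftrightarrow>
    openin X V \<and> x \<in> V \<and> t \<in> carrier (sections F V) \<and> germ X F x V t = germ X F x U s"
proof
  assume "(V, t) \<in> germ X F x U s"
  then obtain W where V: "openin X V" "x \<in> V" "t \<in> carrier (sections F V)"
    and W: "openin X W" "x \<in> W" "W \<subseteq> U \<inter> V" "restr F U W s = restr F V W t"
    by (auto simp: germ_def)
  with germ_eqI[OF U V W]
  show "openin X V \<and> x \<in> V \<and> t \<in> carrier (sections F V) \<and> germ X F x V t = germ X F x U s"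
    by simp
next
  assume "openin X V \<and> x \<in> V \<and> t \<in> carrier (sections F V) \<and> germ X F x V t = germ X F x U s"
  then show "(V, t) \<in> germ X F x U s" using germ_self[of V x t] by auto
qed

lemma germ_eq_iff:
  assumes U: "openin X U" "x \<in> U" "s \<in> carrier (sections F U)"
    and V: "openin X V" "x \<in> V" "t \<in> carrier (sections F V)"
  shows "germ X F x U s = germ X F x V t \<longleftrightarrow>
    (\<exists>W. openin X W \<and> x \<in> W \<and> W \<subseteq> U \<inter> V \<and> restr F U W s = restr F V W t)"
proof
  assume "germ X F x U s = germ X F x V t"
  then have "(V, t) \<in> germ X F x U s" using germ_self[OF V] by simp
  then show "\<exists>W. openin X W \<and> x \<in> W \<and> W \<subseteq> U \<inter> V \<and> restr F U W s = restr F V W t"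
    by (auto simp: germ_def)
next
  assume "\<exists>W. openin X W \<and> x \<in> W \<and> W \<subseteq> U \<inter> V \<and> restr F U W s = restr F V W t"
  then show "germ X F x U s = germ X F x V t" using germ_eqI[OF U V] by blast
qed

lemma germ_restr:
  assumes U: "openin X U" "s \<in> carrier (sections F U)" and V: "openin X V" "x \<in> V" "V \<subseteq> U"
  shows "germ X F x V (restr F U V s) = germ X F x U s"
proof (rule germ_eqI[where W = V])
  show "restr F V V (restr F U V s) = restr F U V s"
    using restr_id[OF V(1)] restr_closed[OF U(1) V(1,3) U(2)] by simp
qed (use assms restr_closed in auto)

lemma germ_in_stalk:
  "openin X U \<Longrightarrow> x \<in> U \<Longrightarrow> s \<in> carrier (sections F U) \<Longrightarrow>
    germ X F x U s \<in> carrier (stalk X F x)"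
  by (auto simp: stalk_def)

lemma stalkE:
  assumes "g \<in> carrier (stalk X F x)"
  obtains U s where "openin X U" "x \<in> U" "s \<in> carrier (sections F U)" "g = germ X F x U s"
  using assms by (auto simp: stalk_def)

text \<open>Removes the unions over representatives from \<open>stalk\<close> and
  \<open>stalk_map\<close>: what remains to be checked is independence of the
  representative.\<close>

lemma UN_germ:
  assumes U: "openin X U" "x \<in> U" "s \<in> carrier (sections F U)"
    and c: "\<And>V t. openin X V \<Longrightarrow> x \<in> V \<Longrightarrow> t \<in> carrier (sections F V) \<Longrightarrow>
      germ X F x V t = germ X F x U s \<Longrightarrow> f V t = c"
  shows "(\<Union>(V, t)\<in>germ X F x U s. f V t) = c"
proof (rule SUP_eq_const)
  show "germ X F x U s \<noteq> {}" using germ_self[OF U] by blast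
  fix p assume "p \<in> germ X F x U s"
  then show "(case p of (V, t) \<Rightarrow> f V t) = c"
    using c mem_germ_iff[OF U] by (cases p) auto
qed

text \<open>If the first factors agree on \<open>M\<close> and the second ones on \<open>N\<close>,
  then both products restrict to the same section over \<open>M \<inter> N\<close>.\<close>

lemma stalk_mult_germ:
  assumes U: "openin X U" "x \<in> U" "s \<in> carrier (sections F U)"
    and V: "openin X V" "x \<in> V" "t \<in> carrier (sections F V)"
  shows "germ X F x U s \<otimes>\<^bsub>stalk X F x\<^esub> germ X F x V t =
    germ X F x (U \<inter> V) (restr F U (U \<inter> V) s \<otimes>\<^bsub>sections F (U \<inter> V)\<^esub> restr F V (U \<inter> V) t)"
proof -
  have "germ X F x (U' \<inter> V') (restr F U' (U' \<inter> V') s' \<otimes>\<^bsub>sections F (U' \<inter> V')\<^esub> restr F V' (U' \<inter> V') t') =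
      germ X F x (U \<inter> V) (restr F U (U \<inter> V) s \<otimes>\<^bsub>sections F (U \<inter> V)\<^esub> restr F V (U \<inter> V) t)"
    if U': "openin X U'" "x \<in> U'" "s' \<in> carrier (sections F U')" "germ X F x U' s' = germ X F x U s"
      and V': "openin X V'" "x \<in> V'" "t' \<in> carrier (sections F V')" "germ X F x V' t' = germ X F x V t"
    for U' V' s' t'
  proof -
    obtain M where M: "openin X M" "x \<in> M" "M \<subseteq> U' \<inter> U" "restr F U' M s' = restr F U M s"
      using germ_eq_iff[OF U'(1-3) U] U'(4) by auto
    obtain N where N: "openin X N" "x \<in> N" "N \<subseteq> V' \<inter> V" "restr F V' N t' = restr F V N t"
      using germ_eq_iff[OF V'(1-3) V] V'(4) by auto
    have o: "openin X (M \<inter> N)" "openin X (U \<inter> V)" "openin X (U' \<inter> V')"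
      using M N U V U' V' by auto
    have s: "restr F U' (M \<inter> N) s' = restr F U (M \<inter> N) s"
      using restr_restr[OF U'(1) M(1) o(1) _ _ U'(3)] restr_restr[OF U(1) M(1) o(1) _ _ U(3)] M by auto
    have t: "restr F V' (M \<inter> N) t' = restr F V (M \<inter> N) t"
      using restr_restr[OF V'(1) N(1) o(1) _ _ V'(3)] restr_restr[OF V(1) N(1) o(1) _ _ V(3)] N by auto
    have rewr: "restr F (A \<inter> B) (M \<inter> N) (restr F A (A \<inter> B) a \<otimes>\<^bsub>sections F (A \<inter> B)\<^esub> restr F B (A \<inter> B) b) =
        restr F A (M \<inter> N) a \<otimes>\<^bsub>sections F (M \<inter> N)\<^esub> restr F B (M \<inter> N) b"
      if "openin X A" "openin X B" "M \<subseteq> A" "N \<subseteq> B"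
        "a \<in> carrier (sections F A)" "b \<in> carrier (sections F B)" for A B a b
    proof -
      have AB: "openin X (A \<inter> B)" "A \<inter> B \<subseteq> A" "A \<inter> B \<subseteq> B" "M \<inter> N \<subseteq> A \<inter> B" using that by auto
      show ?thesis
        using that o(1) AB by (simp add: restr_mult restr_closed restr_restr)
    qed
    show ?thesis
      by (rule germ_eqI[where W = "M \<inter> N"])
        (use U V U' V' M N o s t rewr in \<open>auto intro!: restr_closed sections_mult_closed\<close>)
  qed
  then show ?thesis
    unfolding stalk_def by (auto intro!: UN_germ[OF U] UN_germ[OF V])
qed

lemma germ_mult:
  assumes U: "openin X U" "x \<in> U" "s \<in> carrier (sections F U)" "t \<in> carrier (sections F U)"
  shows "germ X F x U (s \<otimes>\<^bsub>sections F U\<^esub> t) =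
    germ X F x U s \<otimes>\<^bsub>stalk X F x\<^esub> germ X F x U t"
  using stalk_mult_germ[OF U(1-3) U(1,2,4)] U by (simp add: restr_id)

lemma germ_one:
  assumes U: "openin X U" "x \<in> U"
  shows "germ X F x U \<one>\<^bsub>sections F U\<^esub> = \<one>\<^bsub>stalk X F x\<^esub>"
proof -
  have "germ X F x U (restr F (topspace X) U \<one>\<^bsub>sections F (topspace X)\<^esub>) = \<one>\<^bsub>stalk X F x\<^esub>"
    using germ_restr[OF _ _ U, of "topspace X"] openin_subset[OF U(1)]
    by (simp add: stalk_def sections_one_closed)
  then show ?thesis using restr_one[OF _ U(1)] openin_subset[OF U(1)] by simp
qed

text \<open>Over a common neighbourhood the laws of a stalk become laws of one group of
  sections.\<close>

lemma stalk_common: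
  assumes "g \<in> carrier (stalk X F x)" "h \<in> carrier (stalk X F x)"
  obtains U s t where "openin X U" "x \<in> U" "s \<in> carrier (sections F U)" "t \<in> carrier (sections F U)"
    "g = germ X F x U s" "h = germ X F x U t"
proof -
  obtain V s where V: "openin X V" "x \<in> V" "s \<in> carrier (sections F V)" "g = germ X F x V s"
    using stalkE[OF assms(1)] .
  obtain W t where W: "openin X W" "x \<in> W" "t \<in> carrier (sections F W)" "h = germ X F x W t"
    using stalkE[OF assms(2)] .
  have o: "openin X (V \<inter> W)" using V W by blast
  show thesis
  proof (rule that[of "V \<inter> W" "restr F V (V \<inter> W) s" "restr F W (V \<inter> W) t"])
  qed (use V W o in \<open>simp_all add: restr_closed germ_restr\<close>)
qed

lemma stalk_comm_group:
  assumes x: "x \<in> topspace X"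
  shows "comm_group (stalk X F x)"
proof (rule comm_groupI)
  have T: "openin X (topspace X)" by simp
  note one = germ_one[OF T x, symmetric]
  show "\<one>\<^bsub>stalk X F x\<^esub> \<in> carrier (stalk X F x)"
    unfolding one using germ_in_stalk[OF T x sections_one_closed[OF T]] .
  fix g assume g: "g \<in> carrier (stalk X F x)"
  obtain U s where U: "openin X U" "x \<in> U" "s \<in> carrier (sections F U)" "g = germ X F x U s"
    using stalkE[OF g] .
  interpret U: comm_group "sections F U" using sections_comm_group[OF U(1)] .
  show "\<one>\<^bsub>stalk X F x\<^esub> \<otimes>\<^bsub>stalk X F x\<^esub> g = g"
    using germ_mult[OF U(1,2) _ U(3), of "\<one>\<^bsub>sections F U\<^esub>"] U germ_one[OF U(1,2)] by simp
  show "\<exists>h\<in>carrier (stalk X F x). h \<otimes>\<^bsub>stalk X F x\<^esub> g = \<one>\<^bsub>stalk X F x\<^esub>"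
  proof
    show "germ X F x U (inv\<^bsub>sections F U\<^esub> s) \<otimes>\<^bsub>stalk X F x\<^esub> g = \<one>\<^bsub>stalk X F x\<^esub>"
      using germ_mult[OF U(1,2) _ U(3), of "inv\<^bsub>sections F U\<^esub> s"] U germ_one[OF U(1,2)] by simp
    show "germ X F x U (inv\<^bsub>sections F U\<^esub> s) \<in> carrier (stalk X F x)"
      using germ_in_stalk U by simp
  qed
  fix h assume h: "h \<in> carrier (stalk X F x)"
  obtain V t t' where V: "openin X V" "x \<in> V" "t \<in> carrier (sections F V)" "t' \<in> carrier (sections F V)"
    "g = germ X F x V t" "h = germ X F x V t'" using stalk_common[OF g h] .
  interpret V: comm_group "sections F V" using sections_comm_group[OF V(1)] .
  show "g \<otimes>\<^bsub>stalk X F x\<^esub> h \<in> carrier (stalk X F x)"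
    using V by (auto simp flip: germ_mult intro!: germ_in_stalk)
  show "g \<otimes>\<^bsub>stalk X F x\<^esub> h = h \<otimes>\<^bsub>stalk X F x\<^esub> g"
    using V by (simp add: V.m_comm flip: germ_mult)
  fix k assume k: "k \<in> carrier (stalk X F x)"
  obtain W u where W: "openin X W" "x \<in> W" "u \<in> carrier (sections F W)" "k = germ X F x W u"
    using stalkE[OF k] .
  have o: "openin X (V \<inter> W)" using V W by blast
  interpret O: comm_group "sections F (V \<inter> W)" using sections_comm_group[OF o] .
  show "g \<otimes>\<^bsub>stalk X F x\<^esub> h \<otimes>\<^bsub>stalk X F x\<^esub> k = g \<otimes>\<^bsub>stalk X F x\<^esub> (h \<otimes>\<^bsub>stalk X F x\<^esub> k)"
  proof -
    have r: "g = germ X F x (V \<inter> W) (restr F V (V \<inter> W) t)"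
      "h = germ X F x (V \<inter> W) (restr F V (V \<inter> W) t')" "k = germ X F x (V \<inter> W) (restr F W (V \<inter> W) u)"
      using V W o by (simp_all add: germ_restr)
    show ?thesis
      unfolding r using V W o
      by (simp add: restr_closed O.m_assoc flip: germ_mult)
  qed
qed

lemma germ_hom:
  "openin X U \<Longrightarrow> x \<in> U \<Longrightarrow> germ X F x U \<in> hom (sections F U) (stalk X F x)"
  by (rule homI) (auto simp: germ_in_stalk germ_mult)

lemma germ_eq_one_iff:
  assumes U: "openin X U" "x \<in> U" "s \<in> carrier (sections F U)"
  shows "germ X F x U s = \<one>\<^bsub>stalk X F x\<^esub> \<longleftrightarrow>
    (\<exists>W. openin X W \<and> x \<in> W \<and> W \<subseteq> U \<and> restr F U W s = \<one>\<^bsub>sections F W\<^esub>)"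
proof -
  have "germ X F x U s = \<one>\<^bsub>stalk X F x\<^esub> \<longleftrightarrow>
    (\<exists>W. openin X W \<and> x \<in> W \<and> W \<subseteq> U \<inter> U \<and> restr F U W s = restr F U W \<one>\<^bsub>sections F U\<^esub>)"
    using germ_eq_iff[OF U U(1,2) sections_one_closed[OF U(1)]] germ_one[OF U(1,2)] by simp
  also have "\<dots> \<longleftrightarrow> (\<exists>W. openin X W \<and> x \<in> W \<and> W \<subseteq> U \<and> restr F U W s = \<one>\<^bsub>sections F W\<^esub>)"
    using restr_one[OF U(1)] by auto
  finally show ?thesis .
qed

text \<open>A stalk is a filtered colimit of groups of sections. A root exists already over
  \<open>U\<close>; a germ with trivial \<open>n\<close>-th power is represented, after shrinking to
  \<open>W\<close>, by a section with trivial \<open>n\<close>-th power, and that section is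
  trivial.\<close>

lemma stalk_uniquely_divisible:
  assumes x: "x \<in> topspace X" and div: "\<And>U. openin X U \<Longrightarrow> uniquely_divisible (sections F U)"
  shows "uniquely_divisible (stalk X F x)"
proof (rule uniquely_divisibleI)
  show "comm_group (stalk X F x)" using stalk_comm_group[OF x] .
  then have grp: "group (stalk X F x)" by (rule comm_group.axioms)
  fix n :: nat and g assume n: "n > 0" and g: "g \<in> carrier (stalk X F x)"
  obtain U s where U: "openin X U" "x \<in> U" "s \<in> carrier (sections F U)" "g = germ X F x U s"
    using stalkE[OF g] .
  obtain t where t: "t \<in> carrier (sections F U)" "t [^]\<^bsub>sections F U\<^esub> n = s"
    using uniquely_divisible_root[OF div[OF U(1)] n U(3)] .
  note pow = hom_nat_pow[OF germ_hom[OF U(1,2)] _ sections_group[OF U(1)] grp, of _ n]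
  show "\<exists>h\<in>carrier (stalk X F x). h [^]\<^bsub>stalk X F x\<^esub> n = g"
    using pow[OF t(1)] t U germ_in_stalk by metis
  assume "g [^]\<^bsub>stalk X F x\<^esub> n = \<one>\<^bsub>stalk X F x\<^esub>"
  then have "germ X F x U (s [^]\<^bsub>sections F U\<^esub> n) = \<one>\<^bsub>stalk X F x\<^esub>" using pow U by simp
  moreover have "s [^]\<^bsub>sections F U\<^esub> n \<in> carrier (sections F U)"
    using U sections_group by (simp add: group.is_monoid monoid.nat_pow_closed)
  ultimately obtain W where W: "openin X W" "x \<in> W" "W \<subseteq> U"
    "restr F U W (s [^]\<^bsub>sections F U\<^esub> n) = \<one>\<^bsub>sections F W\<^esub>"
    using germ_eq_one_iff[OF U(1,2)] by blast
  interpret W: group "sections F W" using sections_group[OF W(1)] .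
  have "restr F U W s [^]\<^bsub>sections F W\<^esub> n = \<one>\<^bsub>sections F W\<^esub> [^]\<^bsub>sections F W\<^esub> n"
    using hom_nat_pow[OF restr_hom[OF U(1) W(1,3)] U(3) sections_group[OF U(1)] W.is_group, of n] W(4)
    by (metis W.nat_pow_one)
  then have "restr F U W s = \<one>\<^bsub>sections F W\<^esub>"
    using uniquely_divisible_inj[OF div[OF W(1)] n] restr_closed[OF U(1) W(1,3) U(3)] by blast
  then show "g = \<one>\<^bsub>stalk X F x\<^esub>" using germ_eq_one_iff[OF U(1-3)] U(4) W by blast
qed

end

section \<open>The Godement construction\<close>

context abelian_presheaf
begin

lemma openin_topspace: "openin X U \<Longrightarrow> x \<in> U \<Longrightarrow> x \<in> topspace X"
  using openin_subset by blast

abbreviation "C0 U \<equiv> product_group U (stalk X F)"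
abbreviation "qcls U f \<equiv> unit_image X F U #>\<^bsub>C0 U\<^esub> f"

lemma C0_comm_group: "openin X U \<Longrightarrow> comm_group (C0 U)"
  by (intro comm_group_product_group stalk_comm_group openin_topspace)

lemma C0_group: "openin X U \<Longrightarrow> group (C0 U)"
  using C0_comm_group by (rule comm_group.axioms)

lemma C0_restrict_closed:
  "V \<subseteq> U \<Longrightarrow> f \<in> carrier (C0 U) \<Longrightarrow> restrict f V \<in> carrier (C0 V)"
  by (auto simp: PiE_iff)

lemma C0_restrict_hom: "V \<subseteq> U \<Longrightarrow> (\<lambda>f. restrict f V) \<in> hom (C0 U) (C0 V)"
  by (rule homI) (auto simp: PiE_iff fun_eq_iff)

lemma unit_hom: "openin X U \<Longrightarrow> godement_unit X F U \<in> hom (sections F U) (C0 U)"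
  by (rule homI) (auto simp: godement_unit_def germ_in_stalk germ_mult fun_eq_iff)

lemma unit_restr:
  assumes "openin X U" "openin X V" "V \<subseteq> U" "s \<in> carrier (sections F U)"
  shows "restrict (godement_unit X F U s) V = godement_unit X F V (restr F U V s)"
  using assms by (auto simp: godement_unit_def germ_restr fun_eq_iff)

lemma unit_image_subgroup: "openin X U \<Longrightarrow> subgroup (unit_image X F U) (C0 U)"
  unfolding unit_image_def using unit_hom sections_group C0_group
  by (intro group_hom.img_is_subgroup) (auto simp: group_hom_def group_hom_axioms_def)

lemma quot_sections: "sections (godement_quot X F) U = C0 U Mod unit_image X F U"
  by (simp add: godement_quot_def godement_def)

lemma quot_cases:
  assumes "S \<in> carrier (sections (godement_quot X F) U)"
  obtains f where "f \<in> carrier (C0 U)" "S = qcls U f"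
  using assms by (auto simp: quot_sections carrier_FactGroup)

lemma qcls_closed: "f \<in> carrier (C0 U) \<Longrightarrow> qcls U f \<in> carrier (sections (godement_quot X F) U)"
  by (auto simp: quot_sections carrier_FactGroup)

lemma quot_one: "\<one>\<^bsub>sections (godement_quot X F) U\<^esub> = unit_image X F U"
  by (simp add: quot_sections)

lemma qcls_hom: "openin X U \<Longrightarrow> (\<lambda>f. qcls U f) \<in> hom (C0 U) (sections (godement_quot X F) U)"
  unfolding quot_sections
  by (intro normal.r_coset_hom_Mod comm_group.subgroup_imp_normal C0_comm_group unit_image_subgroup)

lemma qcls_eq_one_iff:
  assumes "openin X U" "f \<in> carrier (C0 U)"
  shows "qcls U f = \<one>\<^bsub>sections (godement_quot X F) U\<^esub> \<longleftrightarrow>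
    (\<exists>s\<in>carrier (sections F U). f = godement_unit X F U s)"
  unfolding quot_one
  using comm_group.rcos_eq_subgroup_iff[OF C0_comm_group unit_image_subgroup, OF assms(1,1,2)]
  by (auto simp: unit_image_def)

lemma quot_restr:
  assumes "openin X U" "openin X V" "V \<subseteq> U" "f \<in> carrier (C0 U)"
  shows "restr (godement_quot X F) U V (qcls U f) = qcls V (restrict f V)"
proof -
  have "(\<lambda>f. restrict f V) ` unit_image X F U \<subseteq> unit_image X F V"
    using assms by (auto simp: unit_image_def unit_restr restr_closed)
  then show ?thesis
    using Union_rcos_eq[OF C0_comm_group C0_comm_group unit_image_subgroup unit_image_subgroup
        C0_restrict_hom[OF assms(3)], of f] assms
    by (simp add: godement_quot_def godement_def)
qed

text \<open>This closure property is what allows the cokernel construction to be iterated, and with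
  it every statement of the present context.\<close>

lemma abelian_presheaf_quot: "abelian_presheaf X (godement_quot X F)"
proof (rule abelian_presheaf.intro)
  show "comm_group (sections (godement_quot X F) U)" if "openin X U" for U
    unfolding quot_sections
    using that by (intro comm_group.abelian_FactGroup C0_comm_group unit_image_subgroup)
next
  fix U V assume "openin X U" "openin X V" "V \<subseteq> U"
  then show "restr (godement_quot X F) U V \<in>
      hom (sections (godement_quot X F) U) (sections (godement_quot X F) V)"
    unfolding quot_sections
    by (intro hom_FactGroupI[where \<theta> = "\<lambda>f. restrict f V"] C0_comm_group unit_image_subgroup
        C0_restrict_hom quot_restr)
next
  fix U S assume U: "openin X U" and S: "S \<in> carrier (sections (godement_quot X F) U)"
  obtain f where "f \<in> carrier (C0 U)" "S = qcls U f" using quot_cases[OF S] .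
  then show "restr (godement_quot X F) U U S = S"
    using quot_restr[OF U U] by (auto simp: PiE_restrict)
next
  fix U V W S assume o: "openin X U" "openin X V" "openin X W" "W \<subseteq> V" "V \<subseteq> U"
    and S: "S \<in> carrier (sections (godement_quot X F) U)"
  obtain f where f: "f \<in> carrier (C0 U)" "S = qcls U f" using quot_cases[OF S] .
  have "restrict f V \<in> carrier (C0 V)" using C0_restrict_closed[OF o(5) f(1)] .
  then show "restr (godement_quot X F) V W (restr (godement_quot X F) U V S) =
      restr (godement_quot X F) U W S"
    using o f quot_restr[of U V f] quot_restr[of V W "restrict f V"] quot_restr[of U W f]
    by (simp add: Int_absorb1)
qed

text \<open>Sections of the Godement presheaf obey no continuity condition, so roots can be chosen
  independently at each point.\<close>

lemma C0_uniquely_divisible: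
  assumes U: "openin X U" and div: "\<And>U. openin X U \<Longrightarrow> uniquely_divisible (sections F U)"
  shows "uniquely_divisible (C0 U)"
proof (rule uniquely_divisibleI)
  show "comm_group (C0 U)" using C0_comm_group[OF U] .
  note stalk_div = stalk_uniquely_divisible[OF openin_topspace[OF U] div]
  fix n :: nat and f assume n: "n > 0" and f: "f \<in> carrier (C0 U)"
  have "\<exists>h. h \<in> carrier (stalk X F x) \<and> h [^]\<^bsub>stalk X F x\<^esub> n = f x" if "x \<in> U" for x
  proof -
    have "f x \<in> carrier (stalk X F x)" using f that by auto
    from uniquely_divisible_root[OF stalk_div[OF that] n this] show ?thesis by metis
  qed
  then obtain h where "\<And>x. x \<in> U \<Longrightarrow> h x \<in> carrier (stalk X F x) \<and> h x [^]\<^bsub>stalk X F x\<^esub> n = f x"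
    by metis
  then show "\<exists>h\<in>carrier (C0 U). h [^]\<^bsub>C0 U\<^esub> n = f"
    using f by (intro bexI[of _ "restrict h U"]) (auto simp: product_group_nat_pow PiE_iff fun_eq_iff extensional_def)
  assume one: "f [^]\<^bsub>C0 U\<^esub> n = \<one>\<^bsub>C0 U\<^esub>"
  have pow: "f x [^]\<^bsub>stalk X F x\<^esub> n = \<one>\<^bsub>stalk X F x\<^esub>" if "x \<in> U" for x
    using fun_cong[OF one, of x] that by (simp add: product_group_nat_pow)
  show "f = \<one>\<^bsub>C0 U\<^esub>"
  proof (rule extensionalityI)
    fix x assume x: "x \<in> U"
    interpret stalk: comm_group "stalk X F x" using stalk_comm_group openin_topspace[OF U x] .
    show "f x = \<one>\<^bsub>C0 U\<^esub> x"
      using uniquely_divisible_inj[OF stalk_div[OF x] n, of "f x" "\<one>\<^bsub>stalk X F x\<^esub>"] pow[OF x] f x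
      by (simp add: PiE_iff)
  qed (use f in \<open>auto simp: PiE_iff\<close>)
qed

text \<open>The subgroup divided out is a homomorphic image of the sections of \<open>F\<close>, so
  it contains roots of its own elements; this is the condition under which unique divisibility
  passes to the quotient.\<close>

lemma quot_uniquely_divisible:
  assumes U: "openin X U" and div: "\<And>U. openin X U \<Longrightarrow> uniquely_divisible (sections F U)"
  shows "uniquely_divisible (sections (godement_quot X F) U)"
  unfolding quot_sections
proof (rule uniquely_divisible_FactGroup)
  fix n :: nat and h assume n: "n > 0" and "h \<in> unit_image X F U"
  then obtain s where s: "s \<in> carrier (sections F U)" "h = godement_unit X F U s"
    by (auto simp: unit_image_def)
  obtain t where t: "t \<in> carrier (sections F U)" "t [^]\<^bsub>sections F U\<^esub> n = s"
    using uniquely_divisible_root[OF div[OF U] n s(1)] .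
  show "\<exists>k\<in>unit_image X F U. k [^]\<^bsub>C0 U\<^esub> n = h"
    using hom_nat_pow[OF unit_hom[OF U] t(1) sections_group[OF U] C0_group[OF U], of n] s t
    by (auto simp: unit_image_def)
qed (use U div in \<open>auto intro: C0_comm_group unit_image_subgroup C0_uniquely_divisible\<close>)

lemma cochains_eq: "cochains X F = C0 (topspace X)"
  by (simp add: cochains_def godement_def)

lemma differential_eq:
  "differential X F f = godement_unit X (godement_quot X F) (topspace X) (qcls (topspace X) f)"
  by (simp add: differential_def cochains_eq)

lemma cochains_comm_group: "comm_group (cochains X F)"
  by (simp add: cochains_eq C0_comm_group)

lemma differential_hom: "differential X F \<in> hom (cochains X F) (cochains X (godement_quot X F))"
proof -
  interpret Q: abelian_presheaf X "godement_quot X F" by (rule abelian_presheaf_quot)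
  have "godement_unit X (godement_quot X F) (topspace X) \<circ> qcls (topspace X) \<in>
      hom (cochains X F) (cochains X (godement_quot X F))"
    unfolding cochains_eq Q.cochains_eq by (intro hom_compose[OF qcls_hom Q.unit_hom]) auto
  then show ?thesis by (simp add: differential_eq[abs_def] comp_def)
qed

text \<open>A differential lies by construction in the image of the unit of
  \<open>godement_quot X F\<close>, and that image is exactly what the next differential divides
  out.\<close>

lemma differential_differential:
  assumes "f \<in> carrier (cochains X F)"
  shows "differential X (godement_quot X F) (differential X F f) =
    \<one>\<^bsub>cochains X (godement_quot X (godement_quot X F))\<^esub>"
proof -
  let ?Q = "godement_quot X F" and ?T = "topspace X"
  interpret Q: abelian_presheaf X ?Q by (rule abelian_presheaf_quot)
  interpret QQ: abelian_presheaf X "godement_quot X ?Q" by (rule Q.abelian_presheaf_quot)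
  have q: "qcls ?T f \<in> carrier (sections ?Q ?T)" using assms by (intro qcls_closed) (simp add: cochains_eq)
  then have "Q.qcls ?T (differential X F f) = \<one>\<^bsub>sections (godement_quot X ?Q) ?T\<^esub>"
    using Q.qcls_eq_one_iff[of ?T] hom_in_carrier[OF Q.unit_hom q] by (auto simp: differential_eq)
  then show ?thesis
    using hom_one[OF QQ.unit_hom[of ?T] QQ.sections_group[of ?T] QQ.C0_group[of ?T]]
    by (simp add: Q.differential_eq QQ.cochains_eq)
qed

lemma godement_three_term_complex:
  "three_term_complex (cochains X F) (cochains X (godement_quot X F))
    (cochains X (godement_quot X (godement_quot X F)))
    (differential X F) (differential X (godement_quot X F))"
proof -
  interpret Q: abelian_presheaf X "godement_quot X F" by (rule abelian_presheaf_quot)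
  interpret QQ: abelian_presheaf X "godement_quot X (godement_quot X F)" by (rule Q.abelian_presheaf_quot)
  show ?thesis
    by (intro three_term_complex.intro three_term_complex_axioms.intro cochains_comm_group
        Q.cochains_comm_group QQ.cochains_comm_group differential_hom Q.differential_hom
        differential_differential)
qed

end

section \<open>Morphisms of presheaves and the induced maps of stalks, quotients and
  cochains\<close>

locale presheaf_morphism = A: abelian_presheaf X A + B: abelian_presheaf X B for X A B +
  fixes \<phi>
  assumes map_hom: "openin X U \<Longrightarrow> \<phi> U \<in> hom (sections A U) (sections B U)"
    and natural: "openin X U \<Longrightarrow> openin X V \<Longrightarrow> V \<subseteq> U \<Longrightarrow> s \<in> carrier (sections A U) \<Longrightarrow>
      \<phi> V (restr A U V s) = restr B U V (\<phi> U s)"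
begin

lemma map_closed: "openin X U \<Longrightarrow> s \<in> carrier (sections A U) \<Longrightarrow> \<phi> U s \<in> carrier (sections B U)"
  using map_hom by (rule hom_in_carrier)

lemma stalk_map_germ:
  assumes U: "openin X U" "x \<in> U" "s \<in> carrier (sections A U)"
  shows "stalk_map X B \<phi> x (germ X A x U s) = germ X B x U (\<phi> U s)"
  unfolding stalk_map_def
proof (rule A.UN_germ[OF U])
  fix V t assume V: "openin X V" "x \<in> V" "t \<in> carrier (sections A V)"
    and "germ X A x V t = germ X A x U s"
  then obtain W where W: "openin X W" "x \<in> W" "W \<subseteq> V \<inter> U" "restr A V W t = restr A U W s"
    using A.germ_eq_iff[OF V U] by auto
  show "germ X B x V (\<phi> V t) = germ X B x U (\<phi> U s)"
  proof (rule B.germ_eqI[OF _ _ _ _ _ _ W(1-3)])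
    show "restr B V W (\<phi> V t) = restr B U W (\<phi> U s)"
      using natural[OF V(1) W(1) _ V(3)] natural[OF U(1) W(1) _ U(3)] W by auto
  qed (use U V map_closed in auto)
qed

lemma stalk_map_closed:
  "g \<in> carrier (stalk X A x) \<Longrightarrow> stalk_map X B \<phi> x g \<in> carrier (stalk X B x)"
  by (erule A.stalkE) (simp add: stalk_map_germ B.germ_in_stalk map_closed)

lemma stalk_map_hom: "stalk_map X B \<phi> x \<in> hom (stalk X A x) (stalk X B x)"
proof (rule homI)
  fix g h assume g: "g \<in> carrier (stalk X A x)" and h: "h \<in> carrier (stalk X A x)"
  show "stalk_map X B \<phi> x g \<in> carrier (stalk X B x)" using stalk_map_closed[OF g] .
  obtain U s t where U: "openin X U" "x \<in> U" "s \<in> carrier (sections A U)" "t \<in> carrier (sections A U)"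
    "g = germ X A x U s" "h = germ X A x U t" using A.stalk_common[OF g h] .
  show "stalk_map X B \<phi> x (g \<otimes>\<^bsub>stalk X A x\<^esub> h) =
      stalk_map X B \<phi> x g \<otimes>\<^bsub>stalk X B x\<^esub> stalk_map X B \<phi> x h"
    using U by (simp add: stalk_map_germ map_closed hom_mult[OF map_hom] A.sections_mult_closed
        flip: A.germ_mult B.germ_mult)
qed

lemma godement_map_hom: "godement_map X B \<phi> U \<in> hom (A.C0 U) (B.C0 U)"
  by (rule homI) (auto simp: godement_map_def stalk_map_closed hom_mult[OF stalk_map_hom] fun_eq_iff PiE_iff)

lemma godement_map_restrict:
  "V \<subseteq> U \<Longrightarrow> godement_map X B \<phi> V (restrict f V) = restrict (godement_map X B \<phi> U f) V"
  by (auto simp: godement_map_def fun_eq_iff)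

lemma godement_map_unit:
  "openin X U \<Longrightarrow> s \<in> carrier (sections A U) \<Longrightarrow>
    godement_map X B \<phi> U (godement_unit X A U s) = godement_unit X B U (\<phi> U s)"
  by (auto simp: godement_map_def godement_unit_def stalk_map_germ fun_eq_iff)

lemma quot_map:
  assumes "openin X U" "f \<in> carrier (A.C0 U)"
  shows "godement_quot_map X B \<phi> U (A.qcls U f) = B.qcls U (godement_map X B \<phi> U f)"
proof -
  have "godement_map X B \<phi> U ` unit_image X A U \<subseteq> unit_image X B U"
    using assms by (auto simp: unit_image_def godement_map_unit map_closed)
  then show ?thesis
    using Union_rcos_eq[OF A.C0_comm_group B.C0_comm_group A.unit_image_subgroup B.unit_image_subgroup
        godement_map_hom] assms
    by (simp add: godement_quot_map_def godement_def)
qed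

lemma presheaf_morphism_quot:
  "presheaf_morphism X (godement_quot X A) (godement_quot X B) (godement_quot_map X B \<phi>)"
proof (intro presheaf_morphism.intro presheaf_morphism_axioms.intro A.abelian_presheaf_quot B.abelian_presheaf_quot)
  show "godement_quot_map X B \<phi> U \<in> hom (sections (godement_quot X A) U) (sections (godement_quot X B) U)"
    if "openin X U" for U
    unfolding A.quot_sections B.quot_sections using that
    by (intro hom_FactGroupI[where \<theta> = "godement_map X B \<phi> U"] A.C0_comm_group B.C0_comm_group A.unit_image_subgroup
        B.unit_image_subgroup godement_map_hom quot_map)
  fix U V S assume o: "openin X U" "openin X V" "V \<subseteq> U" and S: "S \<in> carrier (sections (godement_quot X A) U)"
  obtain f where f: "f \<in> carrier (A.C0 U)" "S = A.qcls U f" using A.quot_cases[OF S] .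
  show "godement_quot_map X B \<phi> V (restr (godement_quot X A) U V S) =
      restr (godement_quot X B) U V (godement_quot_map X B \<phi> U S)"
    using o f A.C0_restrict_closed[OF o(3) f(1)] hom_in_carrier[OF godement_map_hom f(1)]
    by (simp add: A.quot_restr B.quot_restr quot_map godement_map_restrict
        del: carrier_product_group)
qed

text \<open>The differential is the class map followed by the unit, and each of them is
  natural.\<close>

lemma differential_cochain_map:
  assumes "f \<in> carrier (cochains X A)"
  shows "cochain_map X (godement_quot X B) (godement_quot_map X B \<phi>) (differential X A f) =
    differential X B (cochain_map X B \<phi> f)"
proof -
  interpret Q: presheaf_morphism X "godement_quot X A" "godement_quot X B" "godement_quot_map X B \<phi>"
    by (rule presheaf_morphism_quot)
  show ?thesis
    using assms
    by (simp add: A.differential_eq B.differential_eq cochain_map_def A.cochains_eq Q.godement_map_unit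
        A.qcls_closed quot_map del: carrier_product_group)
qed

end

section \<open>Exact sequences of presheaves\<close>

text \<open>Exactness of the sequence of stalks, spelled out on sections.\<close>

locale presheaf_exact_sequence =
  \<phi>: presheaf_morphism X A B \<phi> + \<psi>: presheaf_morphism X B C \<psi> for X A B \<phi> C \<psi> +
  assumes \<psi>_\<phi>: "\<And>U s. openin X U \<Longrightarrow> s \<in> carrier (sections A U) \<Longrightarrow>
      \<psi> U (\<phi> U s) = \<one>\<^bsub>sections C U\<^esub>"
    and locally_injective: "\<And>U x s. openin X U \<Longrightarrow> x \<in> U \<Longrightarrow> s \<in> carrier (sections A U) \<Longrightarrow>
      \<phi> U s = \<one>\<^bsub>sections B U\<^esub> \<Longrightarrow>
      \<exists>V. openin X V \<and> x \<in> V \<and> V \<subseteq> U \<and> restr A U V s = \<one>\<^bsub>sections A V\<^esub>"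
    and locally_exact: "\<And>U x t. openin X U \<Longrightarrow> x \<in> U \<Longrightarrow> t \<in> carrier (sections B U) \<Longrightarrow>
      \<psi> U t = \<one>\<^bsub>sections C U\<^esub> \<Longrightarrow>
      \<exists>V s. openin X V \<and> x \<in> V \<and> V \<subseteq> U \<and> s \<in> carrier (sections A V) \<and> \<phi> V s = restr B U V t"
    and locally_surjective: "\<And>U x u. openin X U \<Longrightarrow> x \<in> U \<Longrightarrow> u \<in> carrier (sections C U) \<Longrightarrow>
      \<exists>V t. openin X V \<and> x \<in> V \<and> V \<subseteq> U \<and> t \<in> carrier (sections B V) \<and> \<psi> V t = restr C U V u"
begin

lemma stalk_map_\<psi>_\<phi>:
  assumes "g \<in> carrier (stalk X A x)"
  shows "stalk_map X C \<psi> x (stalk_map X B \<phi> x g) = \<one>\<^bsub>stalk X C x\<^esub>"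
  using assms
  by (auto elim!: \<phi>.A.stalkE simp: \<phi>.stalk_map_germ \<psi>.stalk_map_germ \<phi>.map_closed \<psi>_\<phi> \<psi>.B.germ_one)

lemma stalk_map_\<phi>_one:
  assumes "g \<in> carrier (stalk X A x)" "stalk_map X B \<phi> x g = \<one>\<^bsub>stalk X B x\<^esub>"
  shows "g = \<one>\<^bsub>stalk X A x\<^esub>"
proof -
  obtain U s where U: "openin X U" "x \<in> U" "s \<in> carrier (sections A U)" "g = germ X A x U s"
    using \<phi>.A.stalkE[OF assms(1)] .
  have "germ X B x U (\<phi> U s) = \<one>\<^bsub>stalk X B x\<^esub>" using assms(2) U by (simp add: \<phi>.stalk_map_germ)
  then obtain V where V: "openin X V" "x \<in> V" "V \<subseteq> U" "restr B U V (\<phi> U s) = \<one>\<^bsub>sections B V\<^esub>"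
    using \<phi>.B.germ_eq_one_iff[OF U(1,2) \<phi>.map_closed[OF U(1,3)]] by blast
  then have "\<phi> V (restr A U V s) = \<one>\<^bsub>sections B V\<^esub>" using \<phi>.natural[OF U(1) V(1,3) U(3)] by simp
  then obtain W where W: "openin X W" "x \<in> W" "W \<subseteq> V"
    "restr A V W (restr A U V s) = \<one>\<^bsub>sections A W\<^esub>"
    using locally_injective[OF V(1,2) \<phi>.A.restr_closed[OF U(1) V(1,3) U(3)]] by blast
  then have "restr A U W s = \<one>\<^bsub>sections A W\<^esub>"
    using \<phi>.A.restr_restr[OF U(1) V(1) W(1,3) V(3) U(3)] by simp
  then show ?thesis using \<phi>.A.germ_eq_one_iff[OF U(1-3)] U(4) W V(3) by blast
qed

lemma stalk_exact:
  assumes "h \<in> carrier (stalk X B x)" "stalk_map X C \<psi> x h = \<one>\<^bsub>stalk X C x\<^esub>"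
  shows "\<exists>g\<in>carrier (stalk X A x). stalk_map X B \<phi> x g = h"
proof -
  obtain U t where U: "openin X U" "x \<in> U" "t \<in> carrier (sections B U)" "h = germ X B x U t"
    using \<phi>.B.stalkE[OF assms(1)] .
  have "germ X C x U (\<psi> U t) = \<one>\<^bsub>stalk X C x\<^esub>" using assms(2) U by (simp add: \<psi>.stalk_map_germ)
  then obtain V where V: "openin X V" "x \<in> V" "V \<subseteq> U" "restr C U V (\<psi> U t) = \<one>\<^bsub>sections C V\<^esub>"
    using \<psi>.B.germ_eq_one_iff[OF U(1,2) \<psi>.map_closed[OF U(1,3)]] by blast
  then have "\<psi> V (restr B U V t) = \<one>\<^bsub>sections C V\<^esub>" using \<psi>.natural[OF U(1) V(1,3) U(3)] by simp
  then obtain W s where W: "openin X W" "x \<in> W" "W \<subseteq> V" "s \<in> carrier (sections A W)"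
    "\<phi> W s = restr B V W (restr B U V t)"
    using locally_exact[OF V(1,2) \<phi>.B.restr_closed[OF U(1) V(1,3) U(3)]] by blast
  then have "\<phi> W s = restr B U W t"
    using \<phi>.B.restr_restr[OF U(1) V(1) W(1,3) V(3) U(3)] by simp
  then have "stalk_map X B \<phi> x (germ X A x W s) = h"
    using \<phi>.stalk_map_germ[OF W(1,2,4)] \<phi>.B.germ_restr[OF U(1,3) W(1,2)] W(3) V(3) U(4) by auto
  then show ?thesis using \<phi>.A.germ_in_stalk[OF W(1,2,4)] by blast
qed

lemma stalk_surjective:
  assumes "k \<in> carrier (stalk X C x)"
  shows "\<exists>h\<in>carrier (stalk X B x). stalk_map X C \<psi> x h = k"
proof -
  obtain U u where U: "openin X U" "x \<in> U" "u \<in> carrier (sections C U)" "k = germ X C x U u"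
    using \<psi>.B.stalkE[OF assms(1)] .
  obtain V t where V: "openin X V" "x \<in> V" "V \<subseteq> U" "t \<in> carrier (sections B V)" "\<psi> V t = restr C U V u"
    using locally_surjective[OF U(1-3)] by blast
  then have "stalk_map X C \<psi> x (germ X B x V t) = k"
    using \<psi>.stalk_map_germ[OF V(1,2,4)] \<psi>.B.germ_restr[OF U(1,3) V(1,2,3)] U(4) by simp
  then show ?thesis using \<phi>.B.germ_in_stalk[OF V(1,2,4)] by blast
qed

text \<open>Over \<open>U\<close> the sequence is a product of the exact sequences of stalks, and
  products of exact sequences of groups are exact: preimages are chosen point by point. Thus
  exactness that was only local becomes exactness on sections.\<close>

lemma C0_short_exact:
  assumes U: "openin X U"
  shows "short_exact_groups (\<phi>.A.C0 U) (\<phi>.B.C0 U) (\<psi>.B.C0 U)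
    (godement_map X B \<phi> U) (godement_map X C \<psi> U)"
proof (intro short_exact_groups.intro short_exact_groups_axioms.intro \<phi>.A.C0_comm_group
    \<phi>.B.C0_comm_group \<psi>.B.C0_comm_group \<phi>.godement_map_hom \<psi>.godement_map_hom U)
  note T = \<phi>.A.openin_topspace[OF U]
  interpret A: group "\<phi>.A.C0 U" using \<phi>.A.C0_group[OF U] .
  interpret B: group "\<phi>.B.C0 U" using \<phi>.B.C0_group[OF U] .
  interpret map: group_hom "\<phi>.A.C0 U" "\<phi>.B.C0 U" "godement_map X B \<phi> U"
    by unfold_locales (rule \<phi>.godement_map_hom)
  show "inj_on (godement_map X B \<phi> U) (carrier (\<phi>.A.C0 U))"
    unfolding map.inj_on_one_iff
  proof (intro allI impI)
    fix f assume f: "f \<in> carrier (\<phi>.A.C0 U)" and one: "godement_map X B \<phi> U f = \<one>\<^bsub>\<phi>.B.C0 U\<^esub>"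
    show "f = \<one>\<^bsub>\<phi>.A.C0 U\<^esub>"
    proof (rule extensionalityI)
      fix x assume x: "x \<in> U"
      have "stalk_map X B \<phi> x (f x) = \<one>\<^bsub>stalk X B x\<^esub>"
        using fun_cong[OF one, of x] x by (simp add: godement_map_def)
      then show "f x = \<one>\<^bsub>\<phi>.A.C0 U\<^esub> x"
        using stalk_map_\<phi>_one[of "f x" x] f x by auto
    qed (use f in \<open>auto simp: PiE_iff\<close>)
  qed
  show "kernel (\<phi>.B.C0 U) (\<psi>.B.C0 U) (godement_map X C \<psi> U) = godement_map X B \<phi> U ` carrier (\<phi>.A.C0 U)"
  proof (intro equalityI subsetI)
    fix g assume "g \<in> kernel (\<phi>.B.C0 U) (\<psi>.B.C0 U) (godement_map X C \<psi> U)"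
    then have g: "g \<in> carrier (\<phi>.B.C0 U)" and one: "godement_map X C \<psi> U g = \<one>\<^bsub>\<psi>.B.C0 U\<^esub>"
      by (auto simp: kernel_def)
    have "\<exists>h. h \<in> carrier (stalk X A x) \<and> stalk_map X B \<phi> x h = g x" if x: "x \<in> U" for x
      using stalk_exact[of "g x" x] fun_cong[OF one, of x] g x by (auto simp: godement_map_def)
    then obtain f where "\<And>x. x \<in> U \<Longrightarrow> f x \<in> carrier (stalk X A x) \<and> stalk_map X B \<phi> x (f x) = g x"
      by metis
    then show "g \<in> godement_map X B \<phi> U ` carrier (\<phi>.A.C0 U)"
      using g by (intro image_eqI[of _ _ "restrict f U"])
        (auto simp: godement_map_def PiE_iff extensional_def fun_eq_iff)
  next
    fix g assume "g \<in> godement_map X B \<phi> U ` carrier (\<phi>.A.C0 U)"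
    then obtain f where f: "f \<in> carrier (\<phi>.A.C0 U)" "g = godement_map X B \<phi> U f" by blast
    have "g \<in> carrier (\<phi>.B.C0 U)" unfolding f(2) using hom_in_carrier[OF \<phi>.godement_map_hom f(1)] .
    moreover have "godement_map X C \<psi> U g = \<one>\<^bsub>\<psi>.B.C0 U\<^esub>"
      unfolding f(2) using f(1) by (auto simp: godement_map_def PiE_iff fun_eq_iff stalk_map_\<psi>_\<phi>)
    ultimately show "g \<in> kernel (\<phi>.B.C0 U) (\<psi>.B.C0 U) (godement_map X C \<psi> U)"
      by (simp add: kernel_def)
  qed
  show "godement_map X C \<psi> U ` carrier (\<phi>.B.C0 U) = carrier (\<psi>.B.C0 U)"
  proof (intro equalityI subsetI)
    fix h assume h: "h \<in> carrier (\<psi>.B.C0 U)"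
    have "\<exists>g. g \<in> carrier (stalk X B x) \<and> stalk_map X C \<psi> x g = h x" if x: "x \<in> U" for x
      using stalk_surjective[of "h x" x] h x by auto
    then obtain g where "\<And>x. x \<in> U \<Longrightarrow> g x \<in> carrier (stalk X B x) \<and> stalk_map X C \<psi> x (g x) = h x"
      by metis
    then show "h \<in> godement_map X C \<psi> U ` carrier (\<phi>.B.C0 U)"
      using h by (intro image_eqI[of _ _ "restrict g U"])
        (auto simp: godement_map_def PiE_iff extensional_def fun_eq_iff)
  qed (use hom_in_carrier[OF \<psi>.godement_map_hom] in blast)
qed

lemma cochains_short_exact:
  "short_exact_groups (cochains X A) (cochains X B) (cochains X C) (cochain_map X B \<phi>) (cochain_map X C \<psi>)"
  unfolding cochain_map_def \<phi>.A.cochains_eq \<phi>.B.cochains_eq \<psi>.B.cochains_eq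
  by (rule C0_short_exact) simp

text \<open>The nine lemma: the rows of the given sequence and of its Godement presheaves are exact,
  so the row of cokernels is. Since the first row is exact only locally, the chase may shrink the
  neighbourhood each time it uses that row, while the second row is exact over every open
  set.\<close>

lemma presheaf_exact_sequence_quot:
  "presheaf_exact_sequence X (godement_quot X A) (godement_quot X B) (godement_quot_map X B \<phi>)
    (godement_quot X C) (godement_quot_map X C \<psi>)"
proof (intro presheaf_exact_sequence.intro presheaf_exact_sequence_axioms.intro
    \<phi>.presheaf_morphism_quot \<psi>.presheaf_morphism_quot)
  note C0 [simp del] = carrier_product_group mult_product_group one_product_group
  note \<phi>C0 = hom_in_carrier[OF \<phi>.godement_map_hom] and \<psi>C0 = hom_in_carrier[OF \<psi>.godement_map_hom]
  fix U assume U: "openin X U"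
  interpret E: short_exact_groups "\<phi>.A.C0 U" "\<phi>.B.C0 U" "\<psi>.B.C0 U"
    "godement_map X B \<phi> U" "godement_map X C \<psi> U"
    using C0_short_exact[OF U] .
  {
    fix S assume "S \<in> carrier (sections (godement_quot X A) U)"
    then obtain f where f: "f \<in> carrier (\<phi>.A.C0 U)" "S = \<phi>.A.qcls U f" using \<phi>.A.quot_cases by blast
    have "godement_map X C \<psi> U (godement_map X B \<phi> U f) = \<one>\<^bsub>\<psi>.B.C0 U\<^esub>"
      using E.exact f(1) by (auto simp: kernel_def)
    then show "godement_quot_map X C \<psi> U (godement_quot_map X B \<phi> U S) = \<one>\<^bsub>sections (godement_quot X C) U\<^esub>"
      using f U \<phi>C0[OF f(1)] hom_one[OF \<psi>.B.qcls_hom[OF U] \<psi>.B.C0_group[OF U]]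
        abelian_presheaf.sections_group[OF \<psi>.B.abelian_presheaf_quot U]
      by (simp add: \<phi>.quot_map \<psi>.quot_map)
  next
    fix x S assume x: "x \<in> U" and S: "S \<in> carrier (sections (godement_quot X A) U)"
      and one: "godement_quot_map X B \<phi> U S = \<one>\<^bsub>sections (godement_quot X B) U\<^esub>"
    obtain f where f: "f \<in> carrier (\<phi>.A.C0 U)" "S = \<phi>.A.qcls U f" using \<phi>.A.quot_cases[OF S] .
    obtain t where t: "t \<in> carrier (sections B U)" "godement_map X B \<phi> U f = godement_unit X B U t"
      using one f U \<phi>.B.qcls_eq_one_iff[OF U \<phi>C0[OF f(1)]] by (auto simp: \<phi>.quot_map)
    have germ: "stalk_map X B \<phi> y (f y) = germ X B y U t" if "y \<in> U" for y
      using fun_cong[OF t(2), of y] that by (simp add: godement_map_def godement_unit_def)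
    have stalk: "f y \<in> carrier (stalk X A y)" if "y \<in> U" for y
      using f(1) that by (auto simp: carrier_product_group)
    \<comment> \<open>Near \<open>x\<close> the section \<open>t\<close> should come from
      \<open>A\<close>. At \<open>x\<close> its germ is the image of \<open>f x\<close>, so
      \<open>\<psi>\<close> kills that germ, and therefore kills \<open>t\<close> itself on a
      smaller neighbourhood \<open>V\<close>.\<close>
    have "stalk_map X C \<psi> x (germ X B x U t) = \<one>\<^bsub>stalk X C x\<^esub>"
      using stalk_map_\<psi>_\<phi>[OF stalk[OF x]] germ[OF x] by simp
    then obtain V where V: "openin X V" "x \<in> V" "V \<subseteq> U" "restr C U V (\<psi> U t) = \<one>\<^bsub>sections C V\<^esub>"
      using \<psi>.B.germ_eq_one_iff[OF U x \<psi>.map_closed[OF U t(1)]] \<psi>.stalk_map_germ[OF U x t(1)] by auto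
    then have "\<psi> V (restr B U V t) = \<one>\<^bsub>sections C V\<^esub>" using \<psi>.natural[OF U V(1,3) t(1)] by simp
    then obtain W s where W: "openin X W" "x \<in> W" "W \<subseteq> V" "s \<in> carrier (sections A W)"
      "\<phi> W s = restr B V W (restr B U V t)"
      using locally_exact[OF V(1,2) \<phi>.B.restr_closed[OF U V(1,3) t(1)]] by blast
    then have s: "\<phi> W s = restr B U W t"
      using \<phi>.B.restr_restr[OF U V(1) W(1,3) V(3) t(1)] by simp
    have WU: "W \<subseteq> U" using W V by auto
    interpret EW: short_exact_groups "\<phi>.A.C0 W" "\<phi>.B.C0 W" "\<psi>.B.C0 W"
      "godement_map X B \<phi> W" "godement_map X C \<psi> W"
      using C0_short_exact[OF W(1)] .
    have unit: "godement_unit X A W s \<in> carrier (\<phi>.A.C0 W)"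
      using hom_in_carrier[OF \<phi>.A.unit_hom[OF W(1)] W(4)] .
    have fW: "restrict f W \<in> carrier (\<phi>.A.C0 W)" using \<phi>.A.C0_restrict_closed[OF WU f(1)] .
    \<comment> \<open>Both sides are the unit of the restriction of \<open>t\<close> to
      \<open>W\<close>; injectivity then identifies \<open>f\<close> on \<open>W\<close> with the
      unit of \<open>s\<close>, so its class dies there.\<close>
    have "godement_map X B \<phi> W (restrict f W) = godement_map X B \<phi> W (godement_unit X A W s)"
      using t(2) \<phi>.godement_map_restrict[OF WU] \<phi>.B.unit_restr[OF U W(1) WU t(1)]
        \<phi>.godement_map_unit[OF W(1,4)] s by simp
    then have "restrict f W = godement_unit X A W s"
      using EW.\<phi>_inj fW unit by (auto simp: inj_on_def)
    then have "\<phi>.A.qcls W (restrict f W) = \<one>\<^bsub>sections (godement_quot X A) W\<^esub>"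
      using \<phi>.A.qcls_eq_one_iff[OF W(1) fW] W(4) by blast
    then have "restr (godement_quot X A) U W S = \<one>\<^bsub>sections (godement_quot X A) W\<^esub>"
      using \<phi>.A.quot_restr[OF U W(1) WU f(1)] f(2) by simp
    then show "\<exists>V. openin X V \<and> x \<in> V \<and> V \<subseteq> U \<and>
        restr (godement_quot X A) U V S = \<one>\<^bsub>sections (godement_quot X A) V\<^esub>"
      using W WU by blast
  next
    fix x S assume x: "x \<in> U" and S: "S \<in> carrier (sections (godement_quot X B) U)"
      and one: "godement_quot_map X C \<psi> U S = \<one>\<^bsub>sections (godement_quot X C) U\<^esub>"
    obtain g where g: "g \<in> carrier (\<phi>.B.C0 U)" "S = \<phi>.B.qcls U g" using \<phi>.B.quot_cases[OF S] .
    obtain u where u: "u \<in> carrier (sections C U)" "godement_map X C \<psi> U g = godement_unit X C U u"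
      using one g U \<psi>.B.qcls_eq_one_iff[OF U \<psi>C0[OF g(1)]] by (auto simp: \<psi>.quot_map)
    obtain V t where V: "openin X V" "x \<in> V" "V \<subseteq> U" "t \<in> carrier (sections B V)" "\<psi> V t = restr C U V u"
      using locally_surjective[OF U x u(1)] by blast
    interpret EV: short_exact_groups "\<phi>.A.C0 V" "\<phi>.B.C0 V" "\<psi>.B.C0 V"
      "godement_map X B \<phi> V" "godement_map X C \<psi> V"
      using C0_short_exact[OF V(1)] .
    have unit: "godement_unit X B V t \<in> carrier (\<phi>.B.C0 V)"
      using hom_in_carrier[OF \<phi>.B.unit_hom[OF V(1)] V(4)] .
    have gV: "restrict g V \<in> carrier (\<phi>.B.C0 V)" using \<phi>.B.C0_restrict_closed[OF V(3) g(1)] .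
    \<comment> \<open>\<open>t\<close> lifts \<open>u\<close> over \<open>V\<close>, so correcting
      \<open>g\<close> by the unit of \<open>t\<close> moves it into the kernel of
      \<open>\<psi>\<close> without changing its class.\<close>
    let ?h = "restrict g V \<otimes>\<^bsub>\<phi>.B.C0 V\<^esub> inv\<^bsub>\<phi>.B.C0 V\<^esub> godement_unit X B V t"
    have eq: "godement_map X C \<psi> V (restrict g V) = godement_map X C \<psi> V (godement_unit X B V t)"
      using u(2) \<psi>.godement_map_restrict[OF V(3)] \<psi>.B.unit_restr[OF U V(1,3) u(1)]
        \<psi>.godement_map_unit[OF V(1,4)] V(5) by simp
    have "?h \<in> kernel (\<phi>.B.C0 V) (\<psi>.B.C0 V) (godement_map X C \<psi> V)"
      using gV unit eq \<psi>C0[OF unit]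
        hom_m_inv[OF \<psi>.godement_map_hom EV.B.is_group EV.C.is_group unit]
      by (simp add: kernel_def hom_mult[OF \<psi>.godement_map_hom])
    then obtain f where f: "f \<in> carrier (\<phi>.A.C0 V)" "?h = godement_map X B \<phi> V f"
      using EV.exact by auto
    have "restrict g V = godement_unit X B V t \<otimes>\<^bsub>\<phi>.B.C0 V\<^esub> godement_map X B \<phi> V f"
      unfolding f(2)[symmetric] using gV unit by (simp add: EV.B.m_lcomm)
    then have "\<phi>.B.qcls V (godement_map X B \<phi> V f) = \<phi>.B.qcls V (restrict g V)"
      using EV.B.rcos_eq_iff[OF \<phi>.B.unit_image_subgroup[OF V(1)] \<phi>C0[OF f(1)] gV] V(4)
        EV.B.m_comm[OF unit \<phi>C0[OF f(1)]]
      by (auto simp: unit_image_def)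
    then have "godement_quot_map X B \<phi> V (\<phi>.A.qcls V f) = restr (godement_quot X B) U V S"
      using \<phi>.quot_map[OF V(1) f(1)] \<phi>.B.quot_restr[OF U V(1,3) g(1)] g(2) by simp
    then show "\<exists>V T. openin X V \<and> x \<in> V \<and> V \<subseteq> U \<and> T \<in> carrier (sections (godement_quot X A) V) \<and>
        godement_quot_map X B \<phi> V T = restr (godement_quot X B) U V S"
      using V \<phi>.A.qcls_closed[OF f(1)] by blast
  next
    fix x S assume x: "x \<in> U" and S: "S \<in> carrier (sections (godement_quot X C) U)"
    obtain h where h: "h \<in> carrier (\<psi>.B.C0 U)" "S = \<psi>.B.qcls U h" using \<psi>.B.quot_cases[OF S] .
    obtain g where g: "g \<in> carrier (\<phi>.B.C0 U)" "godement_map X C \<psi> U g = h"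
      using E.\<psi>_surj h(1) by (metis imageE)
    have "godement_quot_map X C \<psi> U (\<phi>.B.qcls U g) = restr (godement_quot X C) U U S"
      using \<psi>.quot_map[OF U g(1)] g(2) h(2)
        abelian_presheaf.restr_id[OF \<psi>.B.abelian_presheaf_quot U S] by simp
    then show "\<exists>V T. openin X V \<and> x \<in> V \<and> V \<subseteq> U \<and> T \<in> carrier (sections (godement_quot X B) V) \<and>
        godement_quot_map X C \<psi> V T = restr (godement_quot X C) U V S"
      using U x \<phi>.B.qcls_closed[OF g(1)] by blast
  }
qed

end

section \<open>The boundary maps on torsion classes\<close>

context presheaf_exact_sequence
begin

theorem boundary1_torsion_iso:
  assumes triv: "trivial_group (sheaf_H1 X B)"
    and div: "\<And>U. openin X U \<Longrightarrow> uniquely_divisible (sections B U)"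
  shows "boundary1 X A B \<phi> C \<psi> \<in> iso (torsion_subgroup (sheaf_H1 X C)) (torsion_subgroup (sheaf_H2 X A))"
proof -
  let ?Q = "godement_quot X"
  let ?q\<phi> = "godement_quot_map X B \<phi>" and ?q\<psi> = "godement_quot_map X C \<psi>"
  let ?qq\<phi> = "godement_quot_map X (?Q B) ?q\<phi>" and ?qq\<psi> = "godement_quot_map X (?Q C) ?q\<psi>"
  let ?qqq\<phi> = "godement_quot_map X (?Q (?Q B)) ?qq\<phi>" and ?qqq\<psi> = "godement_quot_map X (?Q (?Q C)) ?qq\<psi>"
  interpret Q: presheaf_exact_sequence X "?Q A" "?Q B" ?q\<phi> "?Q C" ?q\<psi>
    by (rule presheaf_exact_sequence_quot)
  interpret QQ: presheaf_exact_sequence X "?Q (?Q A)" "?Q (?Q B)" ?qq\<phi> "?Q (?Q C)" ?qq\<psi>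
    by (rule Q.presheaf_exact_sequence_quot)
  \<comment> \<open>The third quotient provides degree 3, where cocycles of degree 2 are
    tested.\<close>
  interpret QQQ: presheaf_exact_sequence X "?Q (?Q (?Q A))" "?Q (?Q (?Q B))" ?qqq\<phi>
    "?Q (?Q (?Q C))" ?qqq\<psi>
    by (rule QQ.presheaf_exact_sequence_quot)
  interpret short_exact_complexes
    "cochains X A" "cochains X (?Q A)" "cochains X (?Q (?Q A))" "cochains X (?Q (?Q (?Q A)))"
    "cochains X B" "cochains X (?Q B)" "cochains X (?Q (?Q B))" "cochains X (?Q (?Q (?Q B)))"
    "cochains X C" "cochains X (?Q C)" "cochains X (?Q (?Q C))" "cochains X (?Q (?Q (?Q C)))"
    "cochain_map X B \<phi>" "cochain_map X (?Q B) ?q\<phi>" "cochain_map X (?Q (?Q B)) ?qq\<phi>"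
    "cochain_map X (?Q (?Q (?Q B))) ?qqq\<phi>"
    "cochain_map X C \<psi>" "cochain_map X (?Q C) ?q\<psi>" "cochain_map X (?Q (?Q C)) ?qq\<psi>"
    "cochain_map X (?Q (?Q (?Q C))) ?qqq\<psi>"
    "differential X (?Q A)" "differential X (?Q (?Q A))"
    "differential X B" "differential X (?Q B)" "differential X (?Q (?Q B))"
    "differential X C" "differential X (?Q C)"
    by (intro short_exact_complexes.intro short_exact_complexes_axioms.intro
        cochains_short_exact Q.cochains_short_exact QQ.cochains_short_exact QQQ.cochains_short_exact
        Q.\<phi>.A.godement_three_term_complex \<phi>.B.godement_three_term_complex
        Q.\<phi>.B.godement_three_term_complex \<psi>.B.godement_three_term_complex
        Q.\<phi>.differential_cochain_map QQ.\<phi>.differential_cochain_map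
        \<psi>.differential_cochain_map Q.\<psi>.differential_cochain_map)
  have H: "sheaf_H1 X F = cohomology (cochains X F) (differential X F) (cochains X (?Q F))
      (differential X (?Q F)) (cochains X (?Q (?Q F)))" for F :: "(_, 'z) presheaf"
    by (simp add: sheaf_H1_def cohomology_def cocycles1_def coboundaries1_def)
  have "boundary1 X A B \<phi> C \<psi> = connecting"
    by (simp add: fun_eq_iff boundary1_def connecting_def Let_def cocycles1_def coboundaries1_def)
  \<comment> \<open>These are the terms of degrees 1 and 2: roots are taken in the first and
    cancelled in the second.\<close>
  moreover have "uniquely_divisible (cochains X (?Q B))" "uniquely_divisible (cochains X (?Q (?Q B)))"
    unfolding Q.\<phi>.B.cochains_eq QQ.\<phi>.B.cochains_eq
    using div by (auto intro!: Q.\<phi>.B.C0_uniquely_divisible QQ.\<phi>.B.C0_uniquely_divisible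
        \<phi>.B.quot_uniquely_divisible Q.\<phi>.B.quot_uniquely_divisible)
  ultimately show ?thesis
    using connecting_torsion_iso triv by (simp add: H sheaf_H2_def)
qed

text \<open>Dimension shift: all groups and maps in question are by definition those of one degree
  lower for the sequence of quotients, which is again exact and whose middle term is again uniquely
  divisible.\<close>

theorem boundary2_torsion_iso:
  assumes triv: "trivial_group (sheaf_H2 X B)"
    and div: "\<And>U. openin X U \<Longrightarrow> uniquely_divisible (sections B U)"
  shows "boundary2 X A B \<phi> C \<psi> \<in> iso (torsion_subgroup (sheaf_H2 X C)) (torsion_subgroup (sheaf_H3 X A))"
proof -
  interpret Q: presheaf_exact_sequence X "godement_quot X A" "godement_quot X B"
    "godement_quot_map X B \<phi>" "godement_quot X C" "godement_quot_map X C \<psi>"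
    by (rule presheaf_exact_sequence_quot)
  show ?thesis
    using Q.boundary1_torsion_iso triv \<phi>.B.quot_uniquely_divisible div
    by (simp add: sheaf_H2_def sheaf_H3_def boundary2_def)
qed

end

section \<open>Presheaves of group-valued functions with a property preserved by the group
  operations\<close>

lemma abelian_presheaf_function_presheaf:
  assumes K: "comm_group K"
    and one: "\<And>U. openin X U \<Longrightarrow> P U (\<lambda>x\<in>U. \<one>\<^bsub>K\<^esub>)"
    and mult: "\<And>U f g. openin X U \<Longrightarrow> f \<in> U \<rightarrow>\<^sub>E carrier K \<Longrightarrow> g \<in> U \<rightarrow>\<^sub>E carrier K \<Longrightarrow>
      P U f \<Longrightarrow> P U g \<Longrightarrow> P U (\<lambda>x\<in>U. f x \<otimes>\<^bsub>K\<^esub> g x)"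
    and inv: "\<And>U f. openin X U \<Longrightarrow> f \<in> U \<rightarrow>\<^sub>E carrier K \<Longrightarrow> P U f \<Longrightarrow> P U (\<lambda>x\<in>U. inv\<^bsub>K\<^esub> f x)"
    and restr: "\<And>U V f. openin X U \<Longrightarrow> openin X V \<Longrightarrow> V \<subseteq> U \<Longrightarrow> f \<in> U \<rightarrow>\<^sub>E carrier K \<Longrightarrow> P U f \<Longrightarrow>
      P V (restrict f V)"
  shows "abelian_presheaf X (function_presheaf K P)"
proof (rule abelian_presheaf.intro)
  interpret K: comm_group K by fact
  fix U assume U: "openin X U"
  have "subgroup {f \<in> U \<rightarrow>\<^sub>E carrier K. P U f} (product_group U (\<lambda>_. K))"
    using U by (intro subgroup.intro) (auto simp: one mult inv intro!: PiE_I)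
  then show "comm_group (sections (function_presheaf K P) U)"
    using comm_group.subgroup_comm_group[OF comm_group_product_group] K
    by (fastforce simp: function_presheaf_def)
next
  fix U V assume "openin X U" "openin X V" "V \<subseteq> U"
  then show "restr (function_presheaf K P) U V \<in>
      hom (sections (function_presheaf K P) U) (sections (function_presheaf K P) V)"
    by (intro homI) (auto simp: function_presheaf_def restr fun_eq_iff PiE_iff)
qed (auto simp: function_presheaf_def PiE_restrict Int_absorb1)

lemma carrier_function_presheaf:
  "carrier (sections (function_presheaf K P) U) = {f \<in> U \<rightarrow>\<^sub>E carrier K. P U f}"
  by (simp add: function_presheaf_def)

lemma presheaf_morphism_function_presheaf:
  assumes "abelian_presheaf X (function_presheaf K P)" "abelian_presheaf X (function_presheaf L R)"
    and h: "h \<in> hom K L"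
    and PR: "\<And>U f. openin X U \<Longrightarrow> f \<in> U \<rightarrow>\<^sub>E carrier K \<Longrightarrow> P U f \<Longrightarrow> R U (\<lambda>x\<in>U. h (f x))"
  shows "presheaf_morphism X (function_presheaf K P) (function_presheaf L R) (\<lambda>U f. \<lambda>x\<in>U. h (f x))"
proof (intro presheaf_morphism.intro presheaf_morphism_axioms.intro assms(1,2) homI)
  fix U f assume U: "openin X U" and f: "f \<in> carrier (sections (function_presheaf K P) U)"
  then show "(\<lambda>x\<in>U. h (f x)) \<in> carrier (sections (function_presheaf L R) U)"
    using PR hom_in_carrier[OF h] by (auto simp: function_presheaf_def PiE_iff)
  fix g assume g: "g \<in> carrier (sections (function_presheaf K P) U)"
  show "(\<lambda>x\<in>U. h ((f \<otimes>\<^bsub>sections (function_presheaf K P) U\<^esub> g) x)) =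
      (\<lambda>x\<in>U. h (f x)) \<otimes>\<^bsub>sections (function_presheaf L R) U\<^esub> (\<lambda>x\<in>U. h (g x))"
    using f g by (auto simp: function_presheaf_def fun_eq_iff PiE_iff hom_mult[OF h])
qed (auto simp: function_presheaf_def fun_eq_iff)

section \<open>The exponential sequence\<close>

lemma proj_holomorphic_subset: "proj_holomorphic W g \<Longrightarrow> W' \<subseteq> W \<Longrightarrow> proj_holomorphic W' g"
  unfolding proj_holomorphic_def by blast

lemma proj_holomorphic_const: "proj_holomorphic W (\<lambda>_. c)"
  unfolding proj_holomorphic_def by (auto intro!: exI[of _ "\<lambda>_. 0"] derivative_eq_intros)

lemma proj_holomorphic_add:
  assumes "proj_holomorphic W f" "proj_holomorphic W g"
  shows "proj_holomorphic W (\<lambda>M. f M + g M)"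
  unfolding proj_holomorphic_def
proof (intro allI impI)
  fix v :: "complex ^ 'a" assume v: "v \<noteq> 0 \<and> proj_point v \<in> W"
  obtain D where D: "((\<lambda>w. f (proj_point w)) has_derivative D) (at v)" "\<And>c w. D (c *s w) = c * D w"
    using assms(1) v unfolding proj_holomorphic_def by blast
  obtain E where E: "((\<lambda>w. g (proj_point w)) has_derivative E) (at v)" "\<And>c w. E (c *s w) = c * E w"
    using assms(2) v unfolding proj_holomorphic_def by blast
  show "\<exists>D. ((\<lambda>w. f (proj_point w) + g (proj_point w)) has_derivative D) (at v) \<and>
      (\<forall>c w. D (c *s w) = c * D w)"
    using has_derivative_add[OF D(1) E(1)] D(2) E(2)
    by (intro exI[of _ "\<lambda>w. D w + E w"]) (simp add: algebra_simps)
qed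

lemma proj_holomorphic_mult:
  assumes "proj_holomorphic W f" "proj_holomorphic W g"
  shows "proj_holomorphic W (\<lambda>M. f M * g M)"
  unfolding proj_holomorphic_def
proof (intro allI impI)
  fix v :: "complex ^ 'a" assume v: "v \<noteq> 0 \<and> proj_point v \<in> W"
  obtain D where D: "((\<lambda>w. f (proj_point w)) has_derivative D) (at v)" "\<And>c w. D (c *s w) = c * D w"
    using assms(1) v unfolding proj_holomorphic_def by blast
  obtain E where E: "((\<lambda>w. g (proj_point w)) has_derivative E) (at v)" "\<And>c w. E (c *s w) = c * E w"
    using assms(2) v unfolding proj_holomorphic_def by blast
  show "\<exists>D. ((\<lambda>w. f (proj_point w) * g (proj_point w)) has_derivative D) (at v) \<and>
      (\<forall>c w. D (c *s w) = c * D w)"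
    using has_derivative_mult[OF D(1) E(1)] D(2) E(2)
    by (intro exI[of _ "\<lambda>w. f (proj_point v) * E w + D w * g (proj_point v)"]) (simp add: algebra_simps)
qed

text \<open>The chain rule; the derivative of \<open>h\<close> is multiplication by a complex
  number, so complex linearity survives.\<close>

lemma proj_holomorphic_compose:
  assumes g: "proj_holomorphic W g"
    and h: "\<And>M. M \<in> W \<Longrightarrow> (h has_field_derivative h' M) (at (g M))"
  shows "proj_holomorphic W (\<lambda>M. h (g M))"
  unfolding proj_holomorphic_def
proof (intro allI impI)
  fix v :: "complex ^ 'a" assume v: "v \<noteq> 0 \<and> proj_point v \<in> W"
  obtain D where D: "((\<lambda>w. g (proj_point w)) has_derivative D) (at v)" "\<And>c w. D (c *s w) = c * D w"
    using g v unfolding proj_holomorphic_def by blast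
  have "(h has_derivative (*) (h' (proj_point v))) (at (g (proj_point v)))"
    using h v by (simp add: has_field_derivative_def)
  from has_derivative_compose[OF D(1) this]
  show "\<exists>D. ((\<lambda>w. h (g (proj_point w))) has_derivative D) (at v) \<and> (\<forall>c w. D (c *s w) = c * D w)"
    using D(2) by (intro exI[of _ "\<lambda>w. h' (proj_point v) * D w"]) (simp add: algebra_simps)
qed

text \<open>Openness in projective space is tested on the preimage among nonzero vectors, where the
  pullback of \<open>g\<close> is differentiable and hence continuous.\<close>

lemma proj_holomorphic_openin_preimage:
  assumes W: "openin proj_topology W" and g: "proj_holomorphic W g" and S: "open S"
  shows "openin proj_topology {M \<in> W. g M \<in> S}"
proof -
  let ?A = "{v. v \<noteq> 0 \<and> proj_point v \<in> W}"
  have A: "open ?A" using W by (simp add: openin_proj_topology)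
  have "continuous_on ?A (\<lambda>v. g (proj_point v))"
    using g unfolding proj_holomorphic_def
    by (intro continuous_at_imp_continuous_on) (blast intro: has_derivative_continuous)
  from continuous_open_preimage[OF this A S]
  have "open (?A \<inter> (\<lambda>v. g (proj_point v)) -` S)" .
  moreover have "?A \<inter> (\<lambda>v. g (proj_point v)) -` S = {v. v \<noteq> 0 \<and> proj_point v \<in> {M \<in> W. g M \<in> S}}"
    by auto
  ultimately show ?thesis using W by (auto simp: openin_proj_topology)
qed

section \<open>Holomorphic functions on open subsets of the analytic space\<close>

lemma openin_analytic_space_Int:
  assumes "openin proj_topology W" "openin (analytic_space Y) U"
  shows "openin (analytic_space Y) (W \<inter> U)"
proof -
  obtain T where "openin proj_topology T" "U = T \<inter> Y"
    using assms(2) by (auto simp: analytic_space_def openin_subtopology)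
  then show ?thesis
    using openin_Int[OF assms(1), of T] by (auto simp: analytic_space_def openin_subtopology)
qed

lemma holomorphic_funE:
  assumes "holomorphic_fun U f" "L \<in> U"
  obtains W g where "openin proj_topology W" "L \<in> W" "proj_holomorphic W g"
    "\<And>M. M \<in> U \<Longrightarrow> M \<in> W \<Longrightarrow> f M = g M"
  using bspec[OF assms(1)[unfolded holomorphic_fun_def] assms(2)] by (elim exE conjE) simp

lemma holomorphic_funI:
  assumes "\<And>L. L \<in> U \<Longrightarrow> \<exists>W g. openin proj_topology W \<and> L \<in> W \<and> proj_holomorphic W g \<and>
    (\<forall>M\<in>U \<inter> W. f M = g M)"
  shows "holomorphic_fun U f"
  unfolding holomorphic_fun_def using assms by (rule ballI)

text \<open>Sections are extensional functions. This passes between a formula and its restriction to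
  the domain, and it also gives restriction to smaller sets.\<close>

lemma holomorphic_fun_subset_cong:
  assumes f: "holomorphic_fun U f" and V: "V \<subseteq> U" and eq: "\<And>M. M \<in> V \<Longrightarrow> f' M = f M"
  shows "holomorphic_fun V f'"
proof (rule holomorphic_funI)
  fix L assume L: "L \<in> V"
  then have "L \<in> U" using V by blast
  from holomorphic_funE[OF f this] obtain W g where "openin proj_topology W" "L \<in> W"
    "proj_holomorphic W g" "\<And>M. M \<in> U \<Longrightarrow> M \<in> W \<Longrightarrow> f M = g M" by metis
  then show "\<exists>W g. openin proj_topology W \<and> L \<in> W \<and> proj_holomorphic W g \<and> (\<forall>M\<in>V \<inter> W. f' M = g M)"
    using V eq by (intro exI[of _ W] exI[of _ g]) auto
qed

lemma openin_analytic_space_subset: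
  "openin (analytic_space Y) U \<Longrightarrow> U \<subseteq> proj_space \<inter> Y"
  by (auto simp: analytic_space_def openin_subtopology openin_proj_topology)

text \<open>An open \<open>V\<close> of the variety is the trace of an ambient open
  \<open>T\<close>. The constant function on \<open>T\<close> is a local extension of
  \<open>f\<close>, because \<open>U\<close> lies in \<open>Y\<close> and so meets \<open>T\<close>
  inside \<open>V\<close>.\<close>

lemma holomorphic_fun_locally_const:
  assumes U: "openin (analytic_space Y) U"
    and f: "\<And>L. L \<in> U \<Longrightarrow> \<exists>V. openin (analytic_space Y) V \<and> L \<in> V \<and> (\<forall>M\<in>V. f M = f L)"
  shows "holomorphic_fun U f"
proof (rule holomorphic_funI)
  fix L assume L: "L \<in> U"
  obtain V where V: "openin (analytic_space Y) V" "L \<in> V" "\<forall>M\<in>V. f M = f L"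
    using f[OF L] by blast
  then obtain T where T: "openin proj_topology T" "V = T \<inter> Y"
    unfolding analytic_space_def openin_subtopology by blast
  have "U \<inter> T \<subseteq> V" using openin_analytic_space_subset[OF U] T(2) by blast
  then have "\<forall>M\<in>U \<inter> T. f M = f L" using V(3) by (meson subsetD)
  then show "\<exists>W g. openin proj_topology W \<and> L \<in> W \<and> proj_holomorphic W g \<and> (\<forall>M\<in>U \<inter> W. f M = g M)"
    using T V(2) proj_holomorphic_const by (intro exI[of _ T] exI[of _ "\<lambda>_. f L"] conjI) blast+
qed

lemma holomorphic_fun_binary:
  fixes U :: "(complex ^ 'n) set set"
  assumes f: "holomorphic_fun U f" and g: "holomorphic_fun U g"
    and op: "\<And>(W :: (complex ^ 'n) set set) f' g'. proj_holomorphic W f' \<Longrightarrow> proj_holomorphic W g' \<Longrightarrow>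
      proj_holomorphic W (\<lambda>M. op (f' M) (g' M))"
  shows "holomorphic_fun U (\<lambda>M. op (f M) (g M))"
proof (rule holomorphic_funI)
  fix L assume L: "L \<in> U"
  from holomorphic_funE[OF f L] obtain W f' where W: "openin proj_topology W" "L \<in> W"
    "proj_holomorphic W f'" "\<And>M. M \<in> U \<Longrightarrow> M \<in> W \<Longrightarrow> f M = f' M" by metis
  from holomorphic_funE[OF g L] obtain W' g' where W': "openin proj_topology W'" "L \<in> W'"
    "proj_holomorphic W' g'" "\<And>M. M \<in> U \<Longrightarrow> M \<in> W' \<Longrightarrow> g M = g' M" by metis
  have "proj_holomorphic (W \<inter> W') (\<lambda>M. op (f' M) (g' M))"
    using W(3) W'(3) by (intro op) (auto elim: proj_holomorphic_subset)
  then show "\<exists>W h. openin proj_topology W \<and> L \<in> W \<and> proj_holomorphic W h \<and>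
      (\<forall>M\<in>U \<inter> W. op (f M) (g M) = h M)"
    using W W' by (intro exI[of _ "W \<inter> W'"] exI[of _ "\<lambda>M. op (f' M) (g' M)"]) auto
qed

lemma holomorphic_fun_compose:
  assumes f: "holomorphic_fun U f" and S: "open S" "\<And>L. L \<in> U \<Longrightarrow> f L \<in> S"
    and h: "\<And>z. z \<in> S \<Longrightarrow> (h has_field_derivative h' z) (at z)"
  shows "holomorphic_fun U (\<lambda>M. h (f M))"
proof (rule holomorphic_funI)
  fix L assume L: "L \<in> U"
  from holomorphic_funE[OF f L] obtain W g where W: "openin proj_topology W" "L \<in> W"
    "proj_holomorphic W g" "\<And>M. M \<in> U \<Longrightarrow> M \<in> W \<Longrightarrow> f M = g M" by metis
  \<comment> \<open>\<open>f\<close> stays in \<open>S\<close>, but its ambient extension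
    \<open>g\<close> may leave it, so the neighbourhood is cut down to where \<open>g\<close> stays
    in the domain of \<open>h\<close>.\<close>
  let ?W = "{M \<in> W. g M \<in> S}"
  have "proj_holomorphic ?W (\<lambda>M. h (g M))"
    by (rule proj_holomorphic_compose[where h' = "\<lambda>M. h' (g M)"])
      (use W(3) h in \<open>auto elim: proj_holomorphic_subset\<close>)
  moreover have "L \<in> ?W" using W L S(2)[OF L] by auto
  ultimately show "\<exists>W k. openin proj_topology W \<and> L \<in> W \<and> proj_holomorphic W k \<and> (\<forall>M\<in>U \<inter> W. h (f M) = k M)"
    using proj_holomorphic_openin_preimage[OF W(1,3) S(1)] W(4)
    by (intro exI[of _ ?W] exI[of _ "\<lambda>M. h (g M)"]) auto
qed

lemma holomorphic_fun_openin_preimage: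
  assumes U: "openin (analytic_space Y) U" and f: "holomorphic_fun U f" and S: "open S"
  shows "openin (analytic_space Y) {M \<in> U. f M \<in> S}"
proof (subst openin_subopen, intro ballI)
  fix L assume L: "L \<in> {M \<in> U. f M \<in> S}"
  then have "L \<in> U" by simp
  from holomorphic_funE[OF f this] obtain W g where W: "openin proj_topology W" "L \<in> W"
    "proj_holomorphic W g" "\<And>M. M \<in> U \<Longrightarrow> M \<in> W \<Longrightarrow> f M = g M" by metis
  show "\<exists>T. openin (analytic_space Y) T \<and> L \<in> T \<and> T \<subseteq> {M \<in> U. f M \<in> S}"
    using openin_analytic_space_Int[OF proj_holomorphic_openin_preimage[OF W(1,3) S] U] W L
    by (intro exI[of _ "{M \<in> W. g M \<in> S} \<inter> U"]) auto
qed

section \<open>The coefficient groups, the three sheaves and the two maps between them\<close>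

lemma complex_add_comm_group: "comm_group complex_add_group"
  by (rule comm_groupI) (auto simp: complex_add_group_def intro: exI[of _ "- x" for x])

lemma inv_complex_add_group: "inv\<^bsub>complex_add_group\<^esub> x = - x"
  by (rule group.inv_equality[OF comm_group.axioms(2)[OF complex_add_comm_group]])
    (auto simp: complex_add_group_def)

lemma complex_mult_comm_group: "comm_group complex_mult_group"
proof (rule comm_groupI)
  show "\<exists>y\<in>carrier complex_mult_group. y \<otimes>\<^bsub>complex_mult_group\<^esub> x = \<one>\<^bsub>complex_mult_group\<^esub>"
    if "x \<in> carrier complex_mult_group" for x
    using that by (intro bexI[of _ "inverse x"]) (auto simp: complex_mult_group_def)
qed (auto simp: complex_mult_group_def)

lemma inv_complex_mult_group: "x \<noteq> 0 \<Longrightarrow> inv\<^bsub>complex_mult_group\<^esub> x = inverse x"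
  by (rule group.inv_equality[OF comm_group.axioms(2)[OF complex_mult_comm_group]])
    (auto simp: complex_mult_group_def)

lemma abelian_presheaf_integer: "abelian_presheaf X (integer_sheaf X)"
  unfolding integer_sheaf_def
proof (rule abelian_presheaf_function_presheaf[OF abelian_integer_group], goal_cases)
  case (1 U) then show ?case by auto
next
  case (2 U f g)
  show ?case
  proof
    fix x assume x: "x \<in> U"
    from 2(4) x obtain V where V: "openin X V" "x \<in> V" "V \<subseteq> U" "\<forall>y\<in>V. f y = f x" by blast
    from 2(5) x obtain V' where V': "openin X V'" "x \<in> V'" "V' \<subseteq> U" "\<forall>y\<in>V'. g y = g x" by blast
    show "\<exists>V. openin X V \<and> x \<in> V \<and> V \<subseteq> U \<and>
        (\<forall>y\<in>V. (\<lambda>x\<in>U. f x \<otimes>\<^bsub>integer_group\<^esub> g x) y = (\<lambda>x\<in>U. f x \<otimes>\<^bsub>integer_group\<^esub> g x) x)"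
    proof (intro exI[of _ "V \<inter> V'"] conjI ballI)
      fix y assume "y \<in> V \<inter> V'"
      then have "f y = f x" "g y = g x" "y \<in> U" using V V' by blast+
      then show "(\<lambda>x\<in>U. f x \<otimes>\<^bsub>integer_group\<^esub> g x) y = (\<lambda>x\<in>U. f x \<otimes>\<^bsub>integer_group\<^esub> g x) x"
        using x by simp
    qed (use V V' in blast)+
  qed
next
  case (3 U f)
  show ?case
  proof
    fix x assume x: "x \<in> U"
    with 3(3) obtain V where V: "openin X V" "x \<in> V" "V \<subseteq> U" "\<forall>y\<in>V. f y = f x" by blast
    show "\<exists>V. openin X V \<and> x \<in> V \<and> V \<subseteq> U \<and>
        (\<forall>y\<in>V. (\<lambda>x\<in>U. inv\<^bsub>integer_group\<^esub> f x) y = (\<lambda>x\<in>U. inv\<^bsub>integer_group\<^esub> f x) x)"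
    proof (intro exI[of _ V] conjI ballI)
      fix y assume "y \<in> V"
      then have "f y = f x" "y \<in> U" using V by blast+
      then show "(\<lambda>x\<in>U. inv\<^bsub>integer_group\<^esub> f x) y = (\<lambda>x\<in>U. inv\<^bsub>integer_group\<^esub> f x) x"
        using x by simp
    qed (use V in blast)+
  qed
next
  case (4 U V f)
  show ?case
  proof
    fix x assume x: "x \<in> V"
    then have "x \<in> U" using 4(3) by blast
    with 4(5) obtain W where W: "openin X W" "x \<in> W" "W \<subseteq> U" "\<forall>y\<in>W. f y = f x" by blast
    show "\<exists>W. openin X W \<and> x \<in> W \<and> W \<subseteq> V \<and> (\<forall>y\<in>W. restrict f V y = restrict f V x)"
    proof (intro exI[of _ "W \<inter> V"] conjI ballI)
      fix y assume "y \<in> W \<inter> V"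
      then have "f y = f x" "y \<in> V" using W by blast+
      then show "restrict f V y = restrict f V x" using x by simp
    qed (use W x 4(2) in blast)+
  qed
qed

lemma abelian_presheaf_holomorphic: "abelian_presheaf (analytic_space Y) holomorphic_sheaf"
  unfolding holomorphic_sheaf_def
proof (rule abelian_presheaf_function_presheaf[OF complex_add_comm_group], goal_cases)
  case (1 U)
  show ?case by (rule holomorphic_fun_locally_const[OF 1]) (use 1 in auto)
next
  case (2 U f g)
  show ?case
    using holomorphic_fun_binary[OF 2(4,5) proj_holomorphic_add]
    by (rule holomorphic_fun_subset_cong) (auto simp: complex_add_group_def)
next
  case (3 U f)
  have "holomorphic_fun U (\<lambda>M. - f M)"
    by (rule holomorphic_fun_compose[OF 3(3), of UNIV uminus "\<lambda>_. -1"])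
      (auto intro!: derivative_eq_intros)
  then show ?case by (rule holomorphic_fun_subset_cong) (auto simp: inv_complex_add_group)
next
  case (4 U V f)
  show ?case using 4(5,3) by (rule holomorphic_fun_subset_cong) simp
qed

lemma abelian_presheaf_holomorphic_units:
  "abelian_presheaf (analytic_space Y) holomorphic_units_sheaf"
  unfolding holomorphic_units_sheaf_def
proof (rule abelian_presheaf_function_presheaf[OF complex_mult_comm_group], goal_cases)
  case (1 U)
  show ?case by (rule holomorphic_fun_locally_const[OF 1]) (use 1 in auto)
next
  case (2 U f g)
  show ?case
    using holomorphic_fun_binary[OF 2(4,5) proj_holomorphic_mult]
    by (rule holomorphic_fun_subset_cong) (auto simp: complex_mult_group_def)
next
  case (3 U f)
  have nz: "f L \<noteq> 0" if "L \<in> U" for L using 3(2) that by (auto simp: complex_mult_group_def)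
  have "holomorphic_fun U (\<lambda>M. inverse (f M))"
    by (rule holomorphic_fun_compose[OF 3(3), of "- {0}" inverse "\<lambda>z. - (inverse z * inverse z)"])
      (use nz in \<open>auto intro!: derivative_eq_intros\<close>)
  then show ?case by (rule holomorphic_fun_subset_cong) (auto simp: inv_complex_mult_group nz)
next
  case (4 U V f)
  show ?case using 4(5,3) by (rule holomorphic_fun_subset_cong) simp
qed

lemma presheaf_morphism_integer_inclusion:
  "presheaf_morphism (analytic_space Y) (integer_sheaf (analytic_space Y)) holomorphic_sheaf integer_inclusion"
  unfolding integer_sheaf_def holomorphic_sheaf_def integer_inclusion_def[abs_def]
proof (rule presheaf_morphism_function_presheaf[where h = of_int])
  show "of_int \<in> hom integer_group complex_add_group"
    by (rule homI) (auto simp: complex_add_group_def)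
  fix U and f :: "(complex ^ 'a) set \<Rightarrow> int"
  assume U: "openin (analytic_space Y) U"
    and f: "\<forall>x\<in>U. \<exists>V. openin (analytic_space Y) V \<and> x \<in> V \<and> V \<subseteq> U \<and> (\<forall>y\<in>V. f y = f x)"
  show "holomorphic_fun U (\<lambda>x\<in>U. of_int (f x))"
  proof (rule holomorphic_fun_locally_const[OF U])
    fix L assume L: "L \<in> U"
    with f obtain V where V: "openin (analytic_space Y) V" "L \<in> V" "V \<subseteq> U" "\<forall>y\<in>V. f y = f L" by blast
    show "\<exists>V. openin (analytic_space Y) V \<and> L \<in> V \<and>
        (\<forall>M\<in>V. (\<lambda>x\<in>U. complex_of_int (f x)) M = (\<lambda>x\<in>U. of_int (f x)) L)"
    proof (intro exI[of _ V] conjI ballI)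
      fix M assume "M \<in> V"
      then have "f M = f L" "M \<in> U" using V by blast+
      then show "(\<lambda>x\<in>U. complex_of_int (f x)) M = (\<lambda>x\<in>U. of_int (f x)) L" using L by simp
    qed (use V in blast)+
  qed
qed (use abelian_presheaf_integer abelian_presheaf_holomorphic in
    \<open>auto simp: integer_sheaf_def holomorphic_sheaf_def\<close>)

lemma presheaf_morphism_exponential_map:
  "presheaf_morphism (analytic_space Y) holomorphic_sheaf holomorphic_units_sheaf exponential_map"
  unfolding holomorphic_sheaf_def holomorphic_units_sheaf_def exponential_map_def[abs_def]
proof (rule presheaf_morphism_function_presheaf[where h = "\<lambda>z. exp (2 * of_real pi * \<i> * z)"])
  show "(\<lambda>z. exp (2 * complex_of_real pi * \<i> * z)) \<in> hom complex_add_group complex_mult_group"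
    by (rule homI) (auto simp: complex_add_group_def complex_mult_group_def ring_distribs exp_add)
  fix U and f :: "(complex ^ 'a) set \<Rightarrow> complex"
  assume f: "holomorphic_fun U f"
  have "holomorphic_fun U (\<lambda>x. exp (2 * complex_of_real pi * \<i> * f x))"
    by (rule holomorphic_fun_compose[OF f, of UNIV "\<lambda>z. exp (2 * complex_of_real pi * \<i> * z)"
          "\<lambda>z. exp (2 * complex_of_real pi * \<i> * z) * (2 * complex_of_real pi * \<i>)"])
      (auto intro!: derivative_eq_intros)
  then show "holomorphic_fun U (\<lambda>x\<in>U. exp (2 * complex_of_real pi * \<i> * f x))"
    by (rule holomorphic_fun_subset_cong) auto
qed (use abelian_presheaf_holomorphic abelian_presheaf_holomorphic_units in
    \<open>auto simp: holomorphic_sheaf_def holomorphic_units_sheaf_def\<close>)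

text \<open>A holomorphic function can be divided by \<open>n\<close> over any open set; this is the
  source of all roots in the proof.\<close>

lemma holomorphic_sheaf_uniquely_divisible:
  assumes U: "openin (analytic_space Y) U"
  shows "uniquely_divisible (sections holomorphic_sheaf U)"
proof (rule uniquely_divisibleI)
  show "comm_group (sections holomorphic_sheaf U)"
    using abelian_presheaf.sections_comm_group[OF abelian_presheaf_holomorphic U] .
  \<comment> \<open>The group is additive underneath, so its powers are integer multiples.\<close>
  have pow: "f [^]\<^bsub>sections holomorphic_sheaf U\<^esub> n = (\<lambda>x\<in>U. of_nat n * f x)" for f and n :: nat
    by (induction n) (auto simp: holomorphic_sheaf_def function_presheaf_def complex_add_group_def
        fun_eq_iff algebra_simps)
  fix n :: nat and f assume n: "n > 0" and f: "f \<in> carrier (sections holomorphic_sheaf U)"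
  then have hol: "holomorphic_fun U f" and ext: "f \<in> extensional U"
    by (auto simp: holomorphic_sheaf_def carrier_function_presheaf PiE_iff)
  have "holomorphic_fun U (\<lambda>x. f x / of_nat n)"
    by (rule holomorphic_fun_compose[OF hol, of UNIV "\<lambda>z. z / of_nat n" "\<lambda>_. 1 / of_nat n"])
      (use n in \<open>auto intro!: derivative_eq_intros\<close>)
  then have "holomorphic_fun U (\<lambda>x\<in>U. f x / of_nat n)"
    by (rule holomorphic_fun_subset_cong) auto
  then have "(\<lambda>x\<in>U. f x / of_nat n) \<in> carrier (sections holomorphic_sheaf U)"
    by (simp add: holomorphic_sheaf_def carrier_function_presheaf complex_add_group_def)
  moreover have "(\<lambda>x\<in>U. f x / of_nat n) [^]\<^bsub>sections holomorphic_sheaf U\<^esub> n = f"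
    unfolding pow using n ext by (auto simp: fun_eq_iff extensional_def)
  ultimately show "\<exists>g\<in>carrier (sections holomorphic_sheaf U). g [^]\<^bsub>sections holomorphic_sheaf U\<^esub> n = f"
    by blast
  assume "f [^]\<^bsub>sections holomorphic_sheaf U\<^esub> n = \<one>\<^bsub>sections holomorphic_sheaf U\<^esub>"
  then have eq: "(\<lambda>x\<in>U. of_nat n * f x) = (\<lambda>x\<in>U. 0)"
    by (simp add: pow) (simp add: holomorphic_sheaf_def function_presheaf_def complex_add_group_def)
  have "f = (\<lambda>x\<in>U. 0)"
  proof (rule extensionalityI[OF ext])
    show "f x = (\<lambda>x\<in>U. 0) x" if "x \<in> U" for x using fun_cong[OF eq, of x] that n by simp
  qed simp
  then show "f = \<one>\<^bsub>sections holomorphic_sheaf U\<^esub>"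
    by (simp add: holomorphic_sheaf_def function_presheaf_def complex_add_group_def)
qed

section \<open>Local logarithms and exactness of the exponential sequence\<close>

lemma holomorphic_fun_local_logarithm:
  assumes U: "openin (analytic_space Y) U" and u: "holomorphic_fun U u"
    and L: "L \<in> U" and nz: "u L \<noteq> 0"
  obtains V f where "openin (analytic_space Y) V" "L \<in> V" "V \<subseteq> U" "holomorphic_fun V f"
    "\<And>M. M \<in> V \<Longrightarrow> exp (2 * of_real pi * \<i> * f M) = u M"
proof -
  let ?S = "{z. z / u L \<notin> \<real>\<^sub>\<le>\<^sub>0}" and ?c = "2 * complex_of_real pi * \<i>"
  \<comment> \<open>\<open>Ln\<close> is cut along the nonpositive reals. Division by
    \<open>u L\<close> moves the value at \<open>L\<close> to 1, off the cut, and the summand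
    \<open>Ln (u L)\<close> restores the lost factor.\<close>
  let ?h = "\<lambda>z. (Ln (z / u L) + Ln (u L)) / ?c"
  have S: "open ?S"
  proof -
    have "open ((\<lambda>z. z / u L) -` (- \<real>\<^sub>\<le>\<^sub>0))"
      using nz by (intro open_vimage continuous_intros) (auto simp: open_Compl)
    then show ?thesis by (simp add: vimage_def)
  qed
  let ?V = "{M \<in> U. u M \<in> ?S}"
  show thesis
  proof (rule that)
    show "openin (analytic_space Y) ?V" by (rule holomorphic_fun_openin_preimage[OF U u S])
    show "L \<in> ?V" using L nz by simp
    show "holomorphic_fun ?V (\<lambda>M. ?h (u M))"
    proof (rule holomorphic_fun_compose[where f = u and h = ?h, OF _ S])
      show "holomorphic_fun ?V u" using u by (rule holomorphic_fun_subset_cong) auto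
      show "(?h has_field_derivative (inverse (z / u L) * (1 / u L)) / ?c) (at z)" if "z \<in> ?S" for z
        using that nz by (auto intro!: derivative_eq_intros)
    qed auto
    fix M assume M: "M \<in> ?V"
    \<comment> \<open>The value 0 lies on the cut, so \<open>?S\<close> excludes it.\<close>
    then have nz': "u M \<noteq> 0" by auto
    have "?c * ?h (u M) = Ln (u M / u L) + Ln (u L)"
      by (rule nonzero_mult_div_cancel_left[of ?c, unfolded times_divide_eq_right[symmetric]]) simp
    then have "exp (?c * ?h (u M)) = exp (Ln (u M / u L)) * exp (Ln (u L))"
      by (metis exp_add)
    also have "\<dots> = u M" using nz nz' by simp
    finally show "exp (?c * ?h (u M)) = u M" .
  qed auto
qed

text \<open>Only surjectivity of the exponential requires a smaller neighbourhood. Injectivity of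
  the inclusion and exactness in the middle hold over \<open>U\<close> itself: a holomorphic
  function with trivial exponential is integer valued and continuous, hence locally
  constant.\<close>

lemma exponential_exact_sequence:
  "presheaf_exact_sequence (analytic_space Y) (integer_sheaf (analytic_space Y)) holomorphic_sheaf
    integer_inclusion holomorphic_units_sheaf exponential_map"
proof (intro presheaf_exact_sequence.intro presheaf_exact_sequence_axioms.intro
    presheaf_morphism_integer_inclusion presheaf_morphism_exponential_map, goal_cases)
  let ?X = "analytic_space Y"
  interpret O: abelian_presheaf ?X holomorphic_sheaf by (rule abelian_presheaf_holomorphic)
  note defs = integer_sheaf_def holomorphic_sheaf_def holomorphic_units_sheaf_def function_presheaf_def
    integer_inclusion_def exponential_map_def complex_add_group_def complex_mult_group_def
  {
    case (1 U s)
    have "exp (2 * complex_of_real pi * \<i> * of_int k) = 1" for k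
      using exp_integer_2pi[of "of_int k"] by (simp add: mult_ac)
    then show ?case by (auto simp: defs fun_eq_iff)
  next
    case (2 U x s)
    have "s = \<one>\<^bsub>sections (integer_sheaf ?X) U\<^esub>"
    proof (rule extensionalityI)
      show "s y = \<one>\<^bsub>sections (integer_sheaf ?X) U\<^esub> y" if "y \<in> U" for y
        using fun_cong[OF 2(4), of y] that by (simp add: defs)
    qed (use 2(3) in \<open>simp_all add: defs PiE_iff\<close>)
    then show ?case
      using 2(1,2) abelian_presheaf.restr_id[OF abelian_presheaf_integer 2(1,3)] by auto
  next
    case (3 U x t)
    have t: "holomorphic_fun U t" "t \<in> extensional U" using 3(3) by (simp_all add: defs PiE_iff)
    have int: "t y \<in> \<int>" if "y \<in> U" for y
    proof -
      have "exp (2 * complex_of_real pi * \<i> * t y) = 1" using fun_cong[OF 3(4), of y] that by (simp add: defs)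
      then obtain k :: int where "Im (2 * complex_of_real pi * \<i> * t y) = of_int (2 * k) * pi"
        "Re (2 * complex_of_real pi * \<i> * t y) = 0" unfolding exp_eq_1 by auto
      then have "t y = of_int k" by (auto simp: complex_eq_iff)
      then show ?thesis by simp
    qed
    \<comment> \<open>Sections of the integer sheaf take values of type \<open>int\<close>; the
      floor of the real part transports the integer-valued \<open>t\<close> there.\<close>
    define s where "s = (\<lambda>y\<in>U. \<lfloor>Re (t y)\<rfloor>)"
    have ts: "t y = of_int (s y)" if "y \<in> U" for y
      using int[OF that] that by (auto simp: s_def elim!: Ints_cases)
    have "\<exists>V. openin ?X V \<and> y \<in> V \<and> V \<subseteq> U \<and> (\<forall>z\<in>V. s z = s y)" if y: "y \<in> U" for y
    proof (intro exI conjI ballI)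
      \<comment> \<open>Distinct integers are at distance at least 1, so \<open>t\<close> is
        constant where it stays in the open unit ball around \<open>t y\<close>.\<close>
      let ?V = "{M \<in> U. t M \<in> ball (t y) 1}"
      show "openin ?X ?V" by (rule holomorphic_fun_openin_preimage[OF 3(1) t(1)]) simp
      fix z assume z: "z \<in> ?V"
      then have "norm (complex_of_int (s y - s z)) < 1"
        using ts[OF y] ts[of z] by (simp add: dist_norm)
      then have "\<bar>s y - s z\<bar> < 1" unfolding norm_of_int by linarith
      then show "s z = s y" by linarith
    qed (use y in auto)
    then have "s \<in> carrier (sections (integer_sheaf ?X) U)" by (simp add: defs s_def)
    moreover have "integer_inclusion U s = restr holomorphic_sheaf U U t"
      using O.restr_id[OF 3(1,3)] ts t(2) by (auto simp: integer_inclusion_def fun_eq_iff extensional_def)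
    ultimately show ?case using 3(1,2) by blast
  next
    case (4 U x u)
    then have u: "holomorphic_fun U u" "u x \<noteq> 0" by (auto simp: defs)
    obtain V f where V: "openin ?X V" "x \<in> V" "V \<subseteq> U" "holomorphic_fun V f"
      "\<And>M. M \<in> V \<Longrightarrow> exp (2 * complex_of_real pi * \<i> * f M) = u M"
      using holomorphic_fun_local_logarithm[OF 4(1) u(1) 4(2) u(2)] by metis
    have "holomorphic_fun V (restrict f V)" using V(4) by (rule holomorphic_fun_subset_cong) auto
    then have "restrict f V \<in> carrier (sections holomorphic_sheaf V)" by (simp add: defs)
    moreover have "exponential_map V (restrict f V) = restr holomorphic_units_sheaf U V u"
      using V(5) by (auto simp: defs fun_eq_iff)
    ultimately show ?case using V by blast
  }
qed

theorem lemma1p1: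
  fixes Y :: "(complex ^ 'n) set set"
  assumes "smooth_projective_variety Y"
    and "trivial_group (sheaf_H2 (analytic_space Y) holomorphic_sheaf)"
  shows "exponential_boundary Y \<in>
    iso (Brauer_group Y)
      (torsion_subgroup (sheaf_H3 (analytic_space Y) (integer_sheaf (analytic_space Y))))"
  unfolding exponential_boundary_def Brauer_group_def
  using assms(2) holomorphic_sheaf_uniquely_divisible
  by (rule presheaf_exact_sequence.boundary2_torsion_iso[OF exponential_exact_sequence])

end
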